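(* Let $\mathcal I\subset S_\infty$ be a symmetric monomial ideal generated by partitions of length $\le m$, and let $I_n=\mathcal I\cap S_n$ for $n\ge 1$. Then there is a finite set $D\subset\{0,1,\dots,m-1\}\times\mathbb Z_{\ge0}^2$ such that for every integer $n\ge m$, $$\{(i,j)\in\mathbb Z^2:\beta_{i,i+j}(I_n)\neq0\}=\Big(\bigcup_{(i,j,c)\in D}\mathcal L\big((i,j),c,n-m\big)\Big)\cup\{(i,j):\beta_{i,i+j}(I_{m-1})\neq 0\}.$$
   Context: Let $\Bbbk$ be a field, $S_\infty=\Bbbk[x_j: j\ge1]$ and $S_n=\Bbbk[x_1,\dots,x_n]\subset S_\infty$ (with $S_0=\Bbbk$, $I_0=\mathcal I\cap\Bbbk$). The infinite symmetric group $\mathfrak S_\infty$ acts on $S_\infty$ by $\sigma(x_i)=x_{\sigma(i)}$; an ideal $\mathcal I\subset S_\infty$ is symmetric if $\sigma(\mathcal I)=\mathcal I$ for all $\sigma\in\mathfrak S_\infty$. A partition of length $k$ is a sequence $\lambda=(\lambda_1,\dots,\lambda_k)$ of positive integers with $\lambda_1\ge\dots\ge\lambda_k$; for $\mathbf a=(a_1,\dots,a_k)\in\mathbb Z_{\ge0}^k$, $x^{\mathbf a}=x_1^{a_1}\cdots x_k^{a_k}$. A symmetric monomial ideal $\mathcal I$ is generated by partitions $\lambda(1),\dots,\lambda(t)$ if $\mathcal I=(\sigma(x^{\lambda(k)}):1\le k\le t,\ \sigma\in\mathfrak S_\infty)$; "generated by partitions of length $\le m$" means it has such a finite generating set with all lengths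 $\le m$. For a homogeneous ideal $I\subset S_n$ (standard grading), $\beta_{i,j}(I)=\dim_\Bbbk\mathrm{Tor}_i^{S_n}(I,\Bbbk)_j$. For integers $i,j,c,\ell\ge0$, the line segment $\mathcal L((i,j),c,\ell)=\{(i+k,j+ck)\in\mathbb Z^2:k=0,1,\dots,\ell\}$. *)

theory Defs
  imports Main "HOL.Vector_Spaces" "HOL-Library.Function_Algebras" "HOL-Combinatorics.Permutations"
begin

(* Monomials of S_infty = k[x_1, x_2, ...] are represented by exponent vectors
   a :: nat => nat with finite support; index j (0-based) stands for x_(j+1).
   S_n = k[x_1..x_n] corresponds to exponent vectors supported in {..<n}. *)

definition supp_in :: "nat \<Rightarrow> (nat \<Rightarrow> nat) \<Rightarrow> bool" where
  "supp_in n a \<longleftrightarrow> (\<forall>j\<ge>n. a j = 0)"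

definition is_partition :: "nat list \<Rightarrow> bool" where
  "is_partition lam \<longleftrightarrow> sorted (rev lam) \<and> (\<forall>x\<in>set lam. 0 < x)"

definition pexp :: "nat list \<Rightarrow> nat \<Rightarrow> nat" where
  "pexp lam = (\<lambda>j. if j < length lam then lam ! j else 0)"

(* monomials (exponent vectors) lying in the symmetric monomial ideal of S_infty
   generated by the partitions in G: x^a is divisible by some sigma(x^lam),
   sigma a finitary permutation of the variables.  sigma(x^lam) has exponent
   lam_k at the variable sigma(k). *)
definition sym_mon_ideal :: "nat list set \<Rightarrow> (nat \<Rightarrow> nat) set" where
  "sym_mon_ideal G = {a. (\<exists>N. supp_in N a) \<and>
      (\<exists>lam\<in>G. \<exists>\<sigma> N. \<sigma> permutes {..<N} \<and> (\<forall>k. pexp lam k \<le> a (\<sigma> k)))}"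

definition restr_ideal :: "nat list set \<Rightarrow> nat \<Rightarrow> (nat \<Rightarrow> nat) set" where
  "restr_ideal G n = {a \<in> sym_mon_ideal G. supp_in n a}"

(* Tor_i^{S_n}(I,k) computed by the Koszul complex I \<otimes> K(x_1,...,x_n).
   For a monomial ideal I of S_n with monomial set E, the component of
   I \<otimes> K_i in multidegree alpha has basis x^(alpha - 1_F) \<otimes> e_F with
   F \<subseteq> {..<n}, |F| = i, 1_F \<le> alpha, x^(alpha - 1_F) \<in> I. *)
definition kbasis :: "(nat \<Rightarrow> nat) set \<Rightarrow> nat \<Rightarrow> (nat \<Rightarrow> nat) \<Rightarrow> nat \<Rightarrow> nat set set" where
  "kbasis E n \<alpha> i = {F. F \<subseteq> {..<n} \<and> card F = i \<and> (\<forall>j\<in>F. 1 \<le> \<alpha> j) \<and>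
       (\<lambda>j. \<alpha> j - (if j \<in> F then 1 else 0)) \<in> E}"

definition kchains :: "(nat \<Rightarrow> nat) set \<Rightarrow> nat \<Rightarrow> (nat \<Rightarrow> nat) \<Rightarrow> nat \<Rightarrow> (nat set \<Rightarrow> 'k::field) set" where
  "kchains E n \<alpha> i = {c. \<forall>F. F \<notin> kbasis E n \<alpha> i \<longrightarrow> c F = 0}"

(* Koszul differential  d(x^b e_F) = sum_{j in F} (-1)^{#{l in F. l<j}} x^(b+e_j) e_(F-{j}),
   written on coefficient functions *)
definition kdiff :: "nat \<Rightarrow> (nat set \<Rightarrow> 'k::field) \<Rightarrow> (nat set \<Rightarrow> 'k)" where
  "kdiff n c = (\<lambda>G. \<Sum>j\<in>{..<n} - G. (-1) ^ card {l\<in>G. l < j} * c (insert j G))"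

definition fscale :: "'k::field \<Rightarrow> (nat set \<Rightarrow> 'k) \<Rightarrow> (nat set \<Rightarrow> 'k)" where
  "fscale a f = (\<lambda>x. a * f x)"

(* dim_k Tor_i^{S_n}(I,k)_alpha = dim ker d_i - dim im d_(i+1) *)
definition betti_mdeg :: "'k::field itself \<Rightarrow> (nat \<Rightarrow> nat) set \<Rightarrow> nat \<Rightarrow> (nat \<Rightarrow> nat) \<Rightarrow> nat \<Rightarrow> nat" where
  "betti_mdeg TYPE('k) E n \<alpha> i =
     vector_space.dim (fscale :: 'k \<Rightarrow> _)
        {c \<in> (kchains E n \<alpha> i :: (nat set \<Rightarrow> 'k) set). kdiff n c = 0}
   - vector_space.dim (fscale :: 'k \<Rightarrow> _)
        (kdiff n ` (kchains E n \<alpha> (Suc i) :: (nat set \<Rightarrow> 'k) set))"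

definition betti :: "'k::field itself \<Rightarrow> (nat \<Rightarrow> nat) set \<Rightarrow> nat \<Rightarrow> int \<Rightarrow> int \<Rightarrow> nat" where
  "betti K E n i j = (if i < 0 \<or> j < 0 then 0 else
     (\<Sum>\<alpha>\<in>{\<alpha>. supp_in n \<alpha> \<and> (\<Sum>l<n. \<alpha> l) = nat j}. betti_mdeg K E n \<alpha> (nat i)))"

definition lseg :: "int \<times> int \<Rightarrow> int \<Rightarrow> nat \<Rightarrow> (int \<times> int) set" where
  "lseg p c l = {(fst p + int k, snd p + c * int k) | k. k \<le> l}"

end

theory Submission
  imports Defs "HOL-Library.Infinite_Set"
begin

text \<open>The Betti number of \<open>I\<^sub>n\<close> in degree \<open>\<alpha>\<close> is the homology of the upper Koszul complex
  \<open>{F. x^(\<alpha> - F) \<in> I}\<close>, which depends only on the support of \<open>\<alpha>\<close>. Let \<open>\<alpha>\<close> have at least \<open>m\<close>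
  nonzero exponents, let \<open>e\<close> be the least of them, \<open>B\<close> the positions where it is attained and \<open>U\<close>
  the rest of the support. If \<open>U\<close> has \<open>m\<close> or more elements, the complex is a cone, since lowering
  an exponent \<open>e\<close> cannot affect divisibility by a generator of length at most \<open>m\<close>. Otherwise a set
  \<open>F\<close> is tested only through \<open>F \<inter> U\<close> and the number of elements of \<open>B\<close> outside \<open>F\<close>. For two
  vertices \<open>v\<close>, \<open>w\<close> of \<open>B\<close> the link of \<open>v\<close> is coned off by \<open>w\<close> inside the deletion of \<open>v\<close>, so
  homology splits. Induction on \<open>B\<close> then shows that adjoining one more exponent \<open>e\<close> shifts the
  nonvanishing homology by exactly one, that is, \<open>(i, j)\<close> moves to \<open>(i + 1, j + e - 1)\<close>. The segments
  therefore come from the \<open>\<alpha>\<close> with exactly \<open>m\<close> nonzero exponents and have slope \<open>e - 1\<close>.\<close>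

section \<open>Homology of subcomplexes of the Koszul complex\<close>

lemma kdiff_add: "kdiff n (b + c) = kdiff n b + kdiff n c"
  by (rule ext) (simp add: kdiff_def sum.distrib[symmetric] algebra_simps)

lemma kdiff_diff: "kdiff n (b - c) = kdiff n b - kdiff n c"
  by (rule ext) (simp add: kdiff_def sum_subtractf[symmetric] algebra_simps)

lemma kdiff_zero: "kdiff n 0 = 0"
  by (rule ext) (simp add: kdiff_def)

lemma kdiff_fscale: "kdiff n (fscale a c) = fscale a (kdiff n c)"
  by (rule ext) (simp add: kdiff_def fscale_def sum_distrib_left algebra_simps)

text \<open>The exponent of a Koszul sign is such a count, so inserting j flips the sign attached to
  k exactly when \<open>j < k\<close>. All later sign computations rest on this.\<close>

lemma card_less_insert:
  fixes G :: "nat set" and j k :: nat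
  assumes "j \<notin> G"
  shows "card {l \<in> insert j G. l < k} = card {l \<in> G. l < k} + (if j < k then 1 else 0)"
proof (cases "j < k")
  case True
  have "{l \<in> insert j G. l < k} = insert j {l \<in> G. l < k}" using True by auto
  moreover have "finite {l \<in> G. l < k}" by (rule finite_subset[of _ "{..<k}"]) auto
  ultimately show ?thesis using assms True by simp
next
  case False
  then have "{l \<in> insert j G. l < k} = {l \<in> G. l < k}" by auto
  then show ?thesis using False by simp
qed

text \<open>Removing j and then k, or k and then j, reaches the same face with opposite
  signs.\<close>

lemma kdiff_kdiff: "kdiff n (kdiff n (c :: nat set \<Rightarrow> 'k::field)) = 0"
proof (rule ext)
  fix G
  let ?A = "{..<n} - G"
  define t where "t j k = (if j = k then 0 else
     (-1) ^ card {l\<in>G. l < j} * ((-1) ^ card {l\<in>insert j G. l < k} * c (insert k (insert j G))))" for j k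
  have anti: "t j k = - t k j" if "j \<in> ?A" "k \<in> ?A" for j k
  proof (cases "j = k")
    case False
    have 1: "card {l\<in>insert j G. l < k} = card {l\<in>G. l < k} + (if j < k then 1 else 0)"
      and 2: "card {l\<in>insert k G. l < j} = card {l\<in>G. l < j} + (if k < j then 1 else 0)"
      by (rule card_less_insert, use that in blast)+
    have 3: "insert k (insert j G) = insert j (insert k G)" by (rule insert_commute)
    show ?thesis
    proof (cases "j < k")
      case True
      then show ?thesis unfolding t_def 1 2 3 power_add by (simp add: mult.left_commute)
    next
      case le: False
      then have "k < j" using False by simp
      then show ?thesis unfolding t_def 1 2 3 power_add by (simp add: mult.left_commute)
    qed
  qed (simp add: t_def)
  have "kdiff n (kdiff n c) G = (\<Sum>j\<in>?A. \<Sum>k\<in>?A. t j k)"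
    unfolding kdiff_def
  proof (rule sum.cong)
    fix j assume j: "j \<in> ?A"
    have "(\<Sum>k\<in>?A. t j k) = (\<Sum>k\<in>{..<n} - insert j G. t j k)"
      by (rule sum.mono_neutral_right) (auto simp: t_def)
    also have "\<dots> = (\<Sum>k\<in>{..<n} - insert j G. (-1) ^ card {l\<in>G. l < j} *
       ((-1) ^ card {l\<in>insert j G. l < k} * c (insert k (insert j G))))"
      by (rule sum.cong) (auto simp: t_def)
    finally show "(- 1) ^ card {l \<in> G. l < j} * (\<Sum>k\<in>{..<n} - insert j G.
        (- 1) ^ card {l \<in> insert j G. l < k} * c (insert k (insert j G))) = (\<Sum>k\<in>?A. t j k)"
      by (simp add: sum_distrib_left)
  qed simp
  \<comment> \<open>The double sum is split into its two triangles, which cancel after a swap.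
    Antisymmetry alone would only give \<open>S = - S\<close>, which says nothing in characteristic
    2.\<close>
  also have "\<dots> = (\<Sum>j\<in>?A. \<Sum>k\<in>?A. (if j < k then t j k else 0) + (if k < j then t j k else 0))"
    by (intro sum.cong refl) (auto simp: t_def)
  also have "\<dots> = (\<Sum>j\<in>?A. \<Sum>k\<in>?A. if j < k then t j k else 0) +
      (\<Sum>j\<in>?A. \<Sum>k\<in>?A. if k < j then t j k else 0)"
    by (simp add: sum.distrib)
  also have "(\<Sum>j\<in>?A. \<Sum>k\<in>?A. if k < j then t j k else 0) =
      (\<Sum>k\<in>?A. \<Sum>j\<in>?A. if k < j then t j k else 0)"
    by (rule sum.swap)
  also have "\<dots> = (\<Sum>k\<in>?A. \<Sum>j\<in>?A. - (if k < j then t k j else 0))"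
  proof (intro sum.cong refl)
    fix k j assume "k \<in> ?A" "j \<in> ?A"
    from anti[OF this(2,1)] show "(if k < j then t j k else 0) = - (if k < j then t k j else 0)" by simp
  qed
  also have "\<dots> = - (\<Sum>k\<in>?A. \<Sum>j\<in>?A. if k < j then t k j else 0)"
    by (simp add: sum_negf)
  finally show "kdiff n (kdiff n c) G = 0 G" by simp
qed

section \<open>Exterior multiplication by a basis vector \<open>e_w\<close>, and the contracting
  homotopy it gives\<close>

definition cone_op :: "nat \<Rightarrow> (nat set \<Rightarrow> 'k::field) \<Rightarrow> nat set \<Rightarrow> 'k" where
  "cone_op w c = (\<lambda>F. if w \<in> F then (-1) ^ card {l\<in>F. l < w} * c (F - {w}) else 0)"

text \<open>The differential is contraction with the functional sending each \<open>e_j\<close>,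
  \<open>j < n\<close>, to 1. Contraction is an antiderivation, so multiplication by
  \<open>e_w\<close> is a contracting homotopy.\<close>

lemma kdiff_cone_op:
  fixes c :: "nat set \<Rightarrow> 'k::field"
  assumes "w < n"
  shows "kdiff n (cone_op w c) + cone_op w (kdiff n c) = c"
proof (rule ext)
  fix G
  show "(kdiff n (cone_op w c) + cone_op w (kdiff n c)) G = c G"
  proof (cases "w \<in> G")
    case False
    have "kdiff n (cone_op w c) G =
        (\<Sum>j\<in>{w}. (-1) ^ card {l\<in>G. l < j} * cone_op w c (insert j G))"
      unfolding kdiff_def using assms False
      by (intro sum.mono_neutral_right) (auto simp: cone_op_def)
    also have "\<dots> = c G"
      using False card_less_insert[OF False, of w]
      by (simp del: insert_iff add: cone_op_def insertI1 flip: power_add mult.assoc)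
    finally show ?thesis using False by (simp add: cone_op_def)
  next
    case True
    define G' where "G' = G - {w}"
    have G: "G = insert w G'" and w: "w \<notin> G'" using True by (auto simp: G'_def)
    let ?s = "(-1) ^ card {l\<in>G'. l < w} :: 'k"
    have s: "card {l\<in>G. l < w} = card {l\<in>G'. l < w}" using card_less_insert[OF w, of w] by (simp only: G) simp
    have "cone_op w (kdiff n c) G = ?s * (\<Sum>j\<in>{..<n} - G'. (-1) ^ card {l\<in>G'. l < j} * c (insert j G'))"
      using True s by (simp add: cone_op_def kdiff_def G'_def[symmetric])
    also have "{..<n} - G' = insert w ({..<n} - G)" using assms w by (auto simp: G)
    also have "(\<Sum>j\<in>insert w ({..<n} - G). (-1) ^ card {l\<in>G'. l < j} * c (insert j G')) =
       ?s * c G + (\<Sum>j\<in>{..<n} - G. (-1) ^ card {l\<in>G'. l < j} * c (insert j G'))"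
      using True by (subst sum.insert) (auto simp: G)
    also have "?s * (?s * c G + (\<Sum>j\<in>{..<n} - G. (-1) ^ card {l\<in>G'. l < j} * c (insert j G'))) =
       c G + (\<Sum>j\<in>{..<n} - G. ?s * ((-1) ^ card {l\<in>G'. l < j} * c (insert j G')))"
      by (simp add: distrib_left sum_distrib_left flip: power_add mult.assoc)
    also have "(\<Sum>j\<in>{..<n} - G. ?s * ((-1) ^ card {l\<in>G'. l < j} * c (insert j G'))) =
       (\<Sum>j\<in>{..<n} - G. - ((-1) ^ card {l\<in>G. l < j} * cone_op w c (insert j G)))"
    proof (intro sum.cong refl)
      fix j assume j: "j \<in> {..<n} - G"
      then have jw: "j < w \<or> w < j" "j \<notin> G" "j \<notin> G'" "j \<noteq> w" using G by auto
      have e: "insert j G - {w} = insert j G'" using jw w by (auto simp: G)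
      have "(-1) ^ card {l\<in>G. l < j} * cone_op w c (insert j G) =
         (-1) ^ card {l\<in>G. l < j} * ((-1) ^ card {l\<in>insert j G. l < w} * c (insert j G'))"
        using True e by (simp add: cone_op_def)
      also have "\<dots> = - (?s * ((-1) ^ card {l\<in>G'. l < j} * c (insert j G')))"
      proof -
        \<comment> \<open>Whichever of j and w is smaller, exactly one of the two counts grows by
          one; this is the single minus sign.\<close>
        have 1: "card {l\<in>G. l < j} = card {l\<in>G'. l < j} + (if w < j then 1 else 0)"
          using card_less_insert[OF w, of j] by (simp only: G)
        have 2: "card {l\<in>insert j G. l < w} = card {l\<in>G'. l < w} + (if j < w then 1 else 0)"
          using card_less_insert[OF jw(2), of w] s by (simp only:)
        show ?thesis
        proof (cases "j < w")
          case True
          then show ?thesis unfolding 1 2 power_add by (simp add: mult.left_commute)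
        next
          case False
          then have "w < j" using jw(4) by simp
          then show ?thesis unfolding 1 2 power_add by (simp add: mult.left_commute)
        qed
      qed
      finally show "?s * ((-1) ^ card {l\<in>G'. l < j} * c (insert j G')) =
         - ((-1) ^ card {l\<in>G. l < j} * cone_op w c (insert j G))" by simp
    qed
    also have "\<dots> = - kdiff n (cone_op w c) G" by (simp add: kdiff_def sum_negf)
    finally show ?thesis by simp
  qed
qed

definition cplx_chains :: "nat set set \<Rightarrow> nat \<Rightarrow> (nat set \<Rightarrow> 'k::field) set" where
  "cplx_chains K i = {c. \<forall>F. \<not> (F \<in> K \<and> card F = i) \<longrightarrow> c F = 0}"

text \<open>Degrees count vertices, so for a simplicial complex K on vertices below n this is
  vanishing of reduced homology in dimension i - 1. Phrasing it as exactness avoids dimensions until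
  Betti numbers enter.\<close>

definition exact_at :: "'k::field itself \<Rightarrow> nat \<Rightarrow> nat set set \<Rightarrow> nat \<Rightarrow> bool" where
  "exact_at TYPE('k) n K i \<longleftrightarrow>
    (\<forall>c \<in> (cplx_chains K i :: (nat set \<Rightarrow> 'k) set). kdiff n c = 0 \<longrightarrow> c \<in> kdiff n ` cplx_chains K (Suc i))"

lemma exact_atD:
  fixes c :: "nat set \<Rightarrow> 'k::field"
  assumes "exact_at TYPE('k) n K i" "c \<in> cplx_chains K i" "kdiff n c = 0"
  obtains b where "b \<in> cplx_chains K (Suc i)" "kdiff n b = c"
  using assms unfolding exact_at_def by blast

lemma exact_atI:
  assumes "\<And>c :: nat set \<Rightarrow> 'k::field. c \<in> cplx_chains K i \<Longrightarrow> kdiff n c = 0 \<Longrightarrow>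
    \<exists>b \<in> cplx_chains K (Suc i). kdiff n b = c"
  shows "exact_at TYPE('k) n K i"
  using assms unfolding exact_at_def by blast

lemma cplx_chains_add: "b \<in> cplx_chains K i \<Longrightarrow> c \<in> cplx_chains K i \<Longrightarrow> b + c \<in> cplx_chains K i"
  by (simp add: cplx_chains_def)

lemma cplx_chains_diff: "b \<in> cplx_chains K i \<Longrightarrow> c \<in> cplx_chains K i \<Longrightarrow> b - c \<in> cplx_chains K i"
  by (simp add: cplx_chains_def)

lemma cplx_chains_mono: "K \<subseteq> K' \<Longrightarrow> c \<in> cplx_chains K i \<Longrightarrow> c \<in> cplx_chains K' i"
  by (auto simp: cplx_chains_def)

lemma cone_op_cplx_chains:
  assumes "c \<in> cplx_chains K i" "\<And>F. F \<in> K \<Longrightarrow> w \<notin> F \<Longrightarrow> insert w F \<in> K'" "\<And>F. F \<in> K \<Longrightarrow> finite F"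
  shows "cone_op w c \<in> cplx_chains K' (Suc i)"
  unfolding cplx_chains_def
proof (intro CollectI allI impI)
  fix F assume F: "\<not> (F \<in> K' \<and> card F = Suc i)"
  show "cone_op w c F = 0"
  proof (rule ccontr)
    assume "cone_op w c F \<noteq> 0"
    then have "w \<in> F" "c (F - {w}) \<noteq> 0" by (auto simp: cone_op_def split: if_splits)
    then have "F - {w} \<in> K" "card (F - {w}) = i" using assms(1) unfolding cplx_chains_def by blast+
    moreover have "insert w (F - {w}) = F" using \<open>w \<in> F\<close> by auto
    moreover have "card (insert w (F - {w})) = Suc i"
      using calculation assms(3)[of "F - {w}"] by (subst card_insert_disjoint) auto
    ultimately show False using F assms(2)[of "F - {w}"] by auto
  qed
qed

text \<open>By the homotopy formula a cycle c is the boundary of \<open>cone_op w c\<close>, and in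
  a cone with apex w this chain stays inside the complex.\<close>

lemma exact_at_cone:
  assumes "w < n" "\<And>F. F \<in> K \<Longrightarrow> insert w F \<in> K" "\<And>F. F \<in> K \<Longrightarrow> finite F"
  shows "exact_at TYPE('k::field) n K i"
proof (rule exact_atI)
  fix c :: "nat set \<Rightarrow> 'k" assume c: "c \<in> cplx_chains K i" "kdiff n c = 0"
  have "cone_op w (0 :: nat set \<Rightarrow> 'k) = 0" by (rule ext) (simp add: cone_op_def)
  then have "kdiff n (cone_op w c) = c" using kdiff_cone_op[OF assms(1), of c] c by simp
  moreover have "cone_op w c \<in> cplx_chains K (Suc i)" by (rule cone_op_cplx_chains[OF c(1)]) (use assms in auto)
  ultimately show "\<exists>b \<in> cplx_chains K (Suc i). kdiff n b = c" by blast
qed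

text \<open>A face with at least \<open>card V\<close> elements must contain w, so
  \<open>cone_op w\<close> kills every chain of this degree, and the homotopy formula forces cycles
  to be zero.\<close>

lemma exact_at_top:
  assumes "finite V" "w \<in> V" "w < n" "K \<subseteq> Pow V" "card V \<le> i"
  shows "exact_at TYPE('k::field) n K i"
proof (rule exact_atI)
  fix c :: "nat set \<Rightarrow> 'k" assume c: "c \<in> cplx_chains K i" "kdiff n c = 0"
  have 0: "cone_op w (0 :: nat set \<Rightarrow> 'k) = 0" by (rule ext) (simp add: cone_op_def)
  have "cone_op w c = 0"
  proof (rule ext, rule ccontr)
    fix F assume "cone_op w c F \<noteq> 0 F"
    then have "w \<in> F" "c (F - {w}) \<noteq> 0" by (auto simp: cone_op_def split: if_splits)
    then have "F - {w} \<in> K" "card (F - {w}) = i" using c(1) unfolding cplx_chains_def by blast+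
    moreover from this have "F - {w} \<subseteq> V - {w}" using assms(4) by auto
    ultimately have "F - {w} \<subseteq> V - {w}" "card (F - {w}) = i" by simp_all
    then have "i \<le> card (V - {w})" using card_mono[of "V - {w}" "F - {w}"] assms by auto
    then show False using assms by (metis card_Diff1_less not_le order_trans)
  qed
  then have "c = 0" using kdiff_cone_op[OF assms(3), of c] c(2) 0 by (simp add: kdiff_zero)
  then show "\<exists>b \<in> cplx_chains K (Suc i). kdiff n b = c"
    by (intro bexI[of _ 0]) (auto simp: kdiff_zero cplx_chains_def)
qed

section \<open>Deletion and link of a vertex\<close>

definition del :: "nat \<Rightarrow> nat set set \<Rightarrow> nat set set" where
  "del v K = {F \<in> K. v \<notin> F}"

definition link :: "nat \<Rightarrow> nat set set \<Rightarrow> nat set set" where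
  "link v K = {F. v \<notin> F \<and> insert v F \<in> K}"

text \<open>Splits an element of the exterior algebra by divisibility by \<open>e_v\<close>. Degree
  0 is listed separately because the link part would live in degree -1.\<close>

lemma link_decomp:
  fixes c :: "nat set \<Rightarrow> 'k::field"
  assumes "c \<in> cplx_chains K i" "\<And>F. F \<in> K \<Longrightarrow> finite F"
  obtains c0 c1 where "c = c0 + cone_op v c1" "c0 \<in> cplx_chains (del v K) i"
    "\<And>F. v \<in> F \<Longrightarrow> c1 F = 0" "\<And>F. F \<notin> link v K \<Longrightarrow> c1 F = 0"
    "\<And>k. i = Suc k \<Longrightarrow> c1 \<in> cplx_chains (link v K) k" "i = 0 \<Longrightarrow> c1 = 0"
proof
  define c0 where "c0 = (\<lambda>F. if v \<in> F then 0 else c F)"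
  \<comment> \<open>The sign cancels the one that \<open>cone_op\<close> introduces.\<close>
  define c1 where "c1 = (\<lambda>F. if v \<in> F then 0 else (-1) ^ card {l\<in>F. l < v} * c (insert v F))"
  show "c = c0 + cone_op v c1"
  proof (rule ext)
    fix F
    have "{l. (l = v \<or> l \<in> F) \<and> l < v} = {l\<in>F. l < v}" "{l \<in> F. l \<noteq> v \<and> l < v} = {l\<in>F. l < v}" by auto
    then show "c F = (c0 + cone_op v c1) F"
      by (cases "v \<in> F") (auto simp: c0_def c1_def cone_op_def insert_absorb simp flip: power_add mult.assoc)
  qed
  show "c0 \<in> cplx_chains (del v K) i" using assms(1) by (auto simp: c0_def cplx_chains_def del_def)
  show "c1 F = 0" if "v \<in> F" for F using that by (simp add: c1_def)
  show *: "c1 F = 0" if "F \<notin> link v K" for F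
    using that assms(1) by (auto simp: c1_def link_def cplx_chains_def)
  have card: "card F = k" if "c1 F \<noteq> 0" "i = Suc k" for F k
  proof -
    have F: "v \<notin> F" "c (insert v F) \<noteq> 0" using that by (auto simp: c1_def split: if_splits)
    then have "insert v F \<in> K" "card (insert v F) = i" using assms(1) by (auto simp: cplx_chains_def)
    then show ?thesis using F(1) that(2) assms(2) by (metis card_insert_disjoint finite_insert nat.inject)
  qed
  show "c1 \<in> cplx_chains (link v K) k" if "i = Suc k" for k
    using * card that by (auto simp: cplx_chains_def)
  show "c1 = 0" if "i = 0"
  proof (rule ext, rule ccontr)
    fix F assume "c1 F \<noteq> 0 F"
    then have F: "v \<notin> F" "c (insert v F) \<noteq> 0" by (auto simp: c1_def split: if_splits)
    then have "insert v F \<in> K" "card (insert v F) = 0" using assms(1) that by (auto simp: cplx_chains_def)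
    moreover have "finite (insert v F)" by (rule assms(2)) fact
    ultimately show False by simp
  qed
qed

lemma kdiff_vfree:
  assumes "\<And>F. v \<in> F \<Longrightarrow> c F = 0" "v \<in> G"
  shows "kdiff n c G = 0"
  unfolding kdiff_def using assms by (intro sum.neutral) auto

text \<open>The boundary of \<open>b0 + e_v b1\<close> is \<open>(d b0 + b1) - e_v (d b1)\<close>.
  Comparing the parts without and with v gives both equations.\<close>

lemma kdiff_decomp:
  fixes b0 b1 c0 c1 :: "nat set \<Rightarrow> 'k::field"
  assumes v: "v < n"
    and vf: "\<And>F. v \<in> F \<Longrightarrow> b0 F = 0" "\<And>F. v \<in> F \<Longrightarrow> b1 F = 0"
       "\<And>F. v \<in> F \<Longrightarrow> c0 F = 0" "\<And>F. v \<in> F \<Longrightarrow> c1 F = 0"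
    and eq: "kdiff n (b0 + cone_op v b1) = c0 + cone_op v c1"
  shows "kdiff n b0 + b1 = c0" "kdiff n b1 = - c1"
proof -
  have e: "kdiff n b0 + b1 - cone_op v (kdiff n b1) = c0 + cone_op v c1"
  proof -
    have "kdiff n (cone_op v b1) = b1 - cone_op v (kdiff n b1)"
      using kdiff_cone_op[OF v, of b1] by (simp add: eq_diff_eq)
    then show ?thesis using eq unfolding kdiff_add by (metis add_diff_eq)
  qed
  show "kdiff n b0 + b1 = c0"
  proof (rule ext)
    fix G
    show "(kdiff n b0 + b1) G = c0 G"
    proof (cases "v \<in> G")
      case True
      then show ?thesis using kdiff_vfree[OF vf(1) True] vf by simp
    next
      case False
      then show ?thesis using fun_cong[OF e, of G] by (simp add: cone_op_def)
    qed
  qed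
  show "kdiff n b1 = - c1"
  proof (rule ext)
    fix G
    show "kdiff n b1 G = (- c1) G"
    proof (cases "v \<in> G")
      case True
      then show ?thesis using kdiff_vfree[OF vf(2) True] vf by simp
    next
      case False
      \<comment> \<open>Evaluating at \<open>insert v G\<close> isolates the coefficient of
        \<open>e_v\<close>; the sign in front of it is invertible.\<close>
      have "(kdiff n b0) (insert v G) = 0" by (rule kdiff_vfree[OF vf(1)]) auto
      then have "(-1) ^ card {l\<in>insert v G. l < v} * (kdiff n b1 G + c1 G) = 0"
        using fun_cong[OF e, of "insert v G"] vf False
        by (simp add: cone_op_def distrib_left neg_eq_iff_add_eq_0)
      then show ?thesis by (simp add: eq_neg_iff_add_eq_0)
    qed
  qed
qed

lemma cone_op_zero: "cone_op w 0 = 0"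
  by (rule ext) (simp add: cone_op_def)

text \<open>If the link of \<open>v\<close> is coned off inside the deletion, the inclusion of the link into the
  deletion is zero in homology and the long exact sequence of the pair splits.\<close>

lemma exact_at_del_link:
  assumes v: "v < n" and w: "w < n" and fin: "\<And>F. F \<in> K \<Longrightarrow> finite F"
    and sub: "link v K \<subseteq> del v K"
    and cone: "\<And>F. F \<in> link v K \<Longrightarrow> insert w F \<in> del v K"
  shows "exact_at TYPE('k::field) n K i \<longleftrightarrow>
    exact_at TYPE('k) n (del v K) i \<and> (\<forall>k. i = Suc k \<longrightarrow> exact_at TYPE('k) n (link v K) k)"
proof (intro iffI conjI allI impI)
  have finL: "finite F" if "F \<in> link v K" for F using that fin[of "insert v F"] by (auto simp: link_def)
  have wL: "kdiff n (cone_op w b) = b" if "kdiff n b = 0" for b :: "nat set \<Rightarrow> 'k"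
    using kdiff_cone_op[OF w, of b] that by (simp add: cone_op_zero)
  have vD: "c F = 0" if "c \<in> cplx_chains (del v K) j" "v \<in> F" for c :: "nat set \<Rightarrow> 'k" and j F
    using that by (auto simp: cplx_chains_def del_def)
  have vL: "c F = 0" if "c \<in> cplx_chains (link v K) j" "v \<in> F" for c :: "nat set \<Rightarrow> 'k" and j F
    using that by (auto simp: cplx_chains_def link_def)
  {
    assume ex: "exact_at TYPE('k) n K i"
    show "exact_at TYPE('k) n (del v K) i"
    proof (rule exact_atI)
      fix c :: "nat set \<Rightarrow> 'k" assume c: "c \<in> cplx_chains (del v K) i" "kdiff n c = 0"
      have "c \<in> cplx_chains K i" by (rule cplx_chains_mono[OF _ c(1)]) (auto simp: del_def)
      then obtain b where b: "b \<in> cplx_chains K (Suc i)" "kdiff n b = c" by (rule exact_atD[OF ex _ c(2)])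
      obtain b0 b1 where d: "b = b0 + cone_op v b1" "b0 \<in> cplx_chains (del v K) (Suc i)"
        "\<And>F. v \<in> F \<Longrightarrow> b1 F = 0" "b1 \<in> cplx_chains (link v K) i"
        using link_decomp[OF b(1) fin] by metis
      have "kdiff n (b0 + cone_op v b1) = c + cone_op v 0" using b d by (simp add: cone_op_zero)
      from kdiff_decomp[OF v vD[OF d(2)] d(3) vD[OF c(1)] _ this]
      have *: "kdiff n b0 + b1 = c" "kdiff n b1 = 0" by simp_all
      \<comment> \<open>Since b1 is a cycle, replacing apex v by apex w keeps the boundary and moves
        the filling off v.\<close>
      have "cone_op w b1 \<in> cplx_chains (del v K) (Suc i)"
        using cone_op_cplx_chains[OF d(4), of w "del v K"] cone finL by auto
      then have "b0 + cone_op w b1 \<in> cplx_chains (del v K) (Suc i)" by (rule cplx_chains_add[OF d(2)])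
      moreover have "kdiff n (b0 + cone_op w b1) = c" using * wL by (simp add: kdiff_add)
      ultimately show "\<exists>b \<in> cplx_chains (del v K) (Suc i). kdiff n b = c" by blast
    qed
    fix k assume k: "i = Suc k"
    show "exact_at TYPE('k) n (link v K) k"
    proof (rule exact_atI)
      fix c :: "nat set \<Rightarrow> 'k" assume c: "c \<in> cplx_chains (link v K) k" "kdiff n c = 0"
      \<comment> \<open>The suspension of c with apexes v and w is a cycle of K. The link part of
        any filling of it bounds c up to sign.\<close>
      have 1: "cone_op w c \<in> cplx_chains (del v K) i"
        using cone_op_cplx_chains[OF c(1), of w "del v K"] cone finL k by auto
      have 2: "cone_op v c \<in> cplx_chains K i"
        using cone_op_cplx_chains[OF c(1), of v K] finL k by (auto simp: link_def)
      have 3: "cone_op w c \<in> cplx_chains K i" by (rule cplx_chains_mono[OF _ 1]) (auto simp: del_def)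
      have "kdiff n (cone_op v c - cone_op w c) = 0"
        using wL[OF c(2)] kdiff_cone_op[OF v, of c] c by (simp add: kdiff_diff cone_op_zero)
      from exact_atD[OF ex cplx_chains_diff[OF 2 3] this] obtain b
        where b: "b \<in> cplx_chains K (Suc i)" "kdiff n b = cone_op v c - cone_op w c" .
      obtain b0 b1 where d: "b = b0 + cone_op v b1" "b0 \<in> cplx_chains (del v K) (Suc i)"
        "\<And>F. v \<in> F \<Longrightarrow> b1 F = 0" "b1 \<in> cplx_chains (link v K) i"
        using link_decomp[OF b(1) fin] by metis
      have "kdiff n (b0 + cone_op v b1) = - cone_op w c + cone_op v c" using b d by simp
      from kdiff_decomp(2)[OF v vD[OF d(2)] d(3) _ vL[OF c(1)] this] have "kdiff n b1 = - c"
        using vD[OF 1] by simp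
      then have "kdiff n (0 - b1) = c" unfolding kdiff_diff kdiff_zero by simp
      moreover have "0 - b1 \<in> cplx_chains (link v K) (Suc k)" using d(4) k by (simp add: cplx_chains_def)
      ultimately show "\<exists>b \<in> cplx_chains (link v K) (Suc k). kdiff n b = c" by blast
    qed
  }
  assume "exact_at TYPE('k) n (del v K) i \<and> (\<forall>k. i = Suc k \<longrightarrow> exact_at TYPE('k) n (link v K) k)"
  then have exD: "exact_at TYPE('k) n (del v K) i"
    and exL: "\<And>k. i = Suc k \<Longrightarrow> exact_at TYPE('k) n (link v K) k" by auto
  show "exact_at TYPE('k) n K i"
  proof (rule exact_atI)
    fix z :: "nat set \<Rightarrow> 'k" assume z: "z \<in> cplx_chains K i" "kdiff n z = 0"
    obtain z0 z1 where d: "z = z0 + cone_op v z1" "z0 \<in> cplx_chains (del v K) i"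
        "\<And>F. v \<in> F \<Longrightarrow> z1 F = 0" "\<And>k. i = Suc k \<Longrightarrow> z1 \<in> cplx_chains (link v K) k" "i = 0 \<Longrightarrow> z1 = 0"
      using link_decomp[OF z(1) fin] by metis
    have "kdiff n (z0 + cone_op v z1) = 0 + cone_op v 0" using z d by (simp add: cone_op_zero)
    from kdiff_decomp[OF v vD[OF d(2)] d(3) _ _ this]
    have *: "kdiff n z0 + z1 = 0" "kdiff n z1 = 0" by simp_all
    \<comment> \<open>The link part z1 is a cycle one degree lower and is filled in the link. In
      degree 0 it vanishes, and \<open>y = 0\<close> serves.\<close>
    obtain y where y: "y \<in> cplx_chains (link v K) i" "kdiff n y = z1"
    proof (cases i)
      case 0
      then show ?thesis using that[of 0] d(5) by (simp add: cplx_chains_def kdiff_zero)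
    next
      case (Suc k)
      then show ?thesis using exact_atD[OF exL d(4) *(2)] that by auto
    qed
    \<comment> \<open>As the link lies in the deletion, \<open>z0 + y\<close> is a cycle there. A
      filling x of it gives the filling \<open>x - cone_op v y\<close> of z.\<close>
    have yD: "y \<in> cplx_chains (del v K) i" by (rule cplx_chains_mono[OF sub y(1)])
    have "kdiff n (z0 + y) = 0" using * y by (simp add: kdiff_add)
    from exact_atD[OF exD cplx_chains_add[OF d(2) yD] this] obtain x
      where x: "x \<in> cplx_chains (del v K) (Suc i)" "kdiff n x = z0 + y" .
    have "kdiff n (x - cone_op v y) = z"
      using kdiff_cone_op[OF v, of y] x y d by (simp add: kdiff_diff algebra_simps)
    moreover have "x \<in> cplx_chains K (Suc i)" by (rule cplx_chains_mono[OF _ x(1)]) (auto simp: del_def)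
    moreover have "cone_op v y \<in> cplx_chains K (Suc i)"
      using cone_op_cplx_chains[OF y(1), of v K] finL by (auto simp: link_def)
    ultimately show "\<exists>b \<in> cplx_chains K (Suc i). kdiff n b = z" using cplx_chains_diff by blast
  qed
qed

lemma cplx_chains_kdiff_cong:
  fixes c :: "nat set \<Rightarrow> 'k::field"
  assumes "n \<le> n'" "K \<subseteq> Pow {..<n}" "c \<in> cplx_chains K i"
  shows "kdiff n' c = kdiff n c"
proof (rule ext)
  fix G
  show "kdiff n' c G = kdiff n c G"
    unfolding kdiff_def
  proof (rule sum.mono_neutral_right)
    show "\<forall>j\<in>{..<n'} - G - ({..<n} - G). (- 1) ^ card {l \<in> G. l < j} * c (insert j G) = 0"
    proof
      fix j assume "j \<in> {..<n'} - G - ({..<n} - G)"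
      then have "insert j G \<notin> K" using assms(2) by auto
      then show "(- 1) ^ card {l \<in> G. l < j} * c (insert j G) = 0"
        using assms(3) by (simp add: cplx_chains_def)
    qed
  qed (use assms(1) in auto)
qed

text \<open>Vertices outside the complex contribute only zero terms to the differential, so
  variables may be added without changing homology.\<close>

lemma exact_at_dim_cong:
  assumes "n \<le> n'" "K \<subseteq> Pow {..<n}"
  shows "exact_at TYPE('k::field) n' K i \<longleftrightarrow> exact_at TYPE('k) n K i"
proof -
  have "kdiff n' ` (cplx_chains K (Suc i) :: (nat set \<Rightarrow> 'k) set) = kdiff n ` cplx_chains K (Suc i)"
    using cplx_chains_kdiff_cong[OF assms] by (intro image_cong) auto
  then show ?thesis unfolding exact_at_def using cplx_chains_kdiff_cong[OF assms] by metis
qed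

section \<open>Order-preserving relabelling of vertices\<close>

definition relabel :: "(nat \<Rightarrow> nat) \<Rightarrow> nat set \<Rightarrow> (nat set \<Rightarrow> 'k::field) \<Rightarrow> nat set \<Rightarrow> 'k" where
  "relabel f V c = (\<lambda>F. if F \<subseteq> V then c (f ` F) else 0)"

text \<open>An increasing f preserves the counts of smaller elements, hence all Koszul
  signs.\<close>

lemma kdiff_relabel:
  fixes c :: "nat set \<Rightarrow> 'k::field"
  assumes f: "bij_betw f V' V" "strict_mono_on V' f" and n: "V \<subseteq> {..<n}" "V' \<subseteq> {..<n}"
    and c: "\<And>F. \<not> F \<subseteq> V \<Longrightarrow> c F = 0"
  shows "kdiff n (relabel f V' c) = relabel f V' (kdiff n c)"
proof (rule ext)
  fix G
  show "kdiff n (relabel f V' c) G = relabel f V' (kdiff n c) G"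
  proof (cases "G \<subseteq> V'")
    case False
    then have "kdiff n (relabel f V' c) G = 0"
      unfolding kdiff_def by (intro sum.neutral) (auto simp: relabel_def)
    then show ?thesis using False by (simp add: relabel_def)
  next
    case True
    have inj: "inj_on f V'" and im: "f ` V' = V" using f(1) by (auto simp: bij_betw_def)
    have "kdiff n (relabel f V' c) G =
        (\<Sum>j\<in>V' - G. (-1) ^ card {l\<in>G. l < j} * c (insert (f j) (f ` G)))"
      unfolding kdiff_def using n(2) True
      by (intro sum.mono_neutral_cong_right) (auto simp: relabel_def)
    also have "\<dots> = (\<Sum>j\<in>V' - G. (-1) ^ card {l\<in>f ` G. l < f j} * c (insert (f j) (f ` G)))"
    proof (intro sum.cong refl)
      fix j assume j: "j \<in> V' - G"
      have "{l\<in>f ` G. l < f j} = f ` {l\<in>G. l < j}"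
        using j True f(2) by (auto simp: strict_mono_on_less)
      moreover have "inj_on f {l\<in>G. l < j}" by (rule inj_on_subset[OF inj]) (use True in auto)
      ultimately have "card {l\<in>f ` G. l < f j} = card {l\<in>G. l < j}" by (simp add: card_image)
      then show "(-1) ^ card {l\<in>G. l < j} * c (insert (f j) (f ` G)) =
        (-1) ^ card {l\<in>f ` G. l < f j} * c (insert (f j) (f ` G))" by (simp only:)
    qed
    also have "\<dots> = (\<Sum>j\<in>f ` (V' - G). (-1) ^ card {l\<in>f ` G. l < j} * c (insert j (f ` G)))"
      using inj_on_subset[OF inj, of "V' - G"] by (simp add: sum.reindex)
    also have "f ` (V' - G) = V - f ` G"
      using inj im True by (metis inj_on_image_set_diff Diff_subset)
    also have "(\<Sum>j\<in>V - f ` G. (-1) ^ card {l\<in>f ` G. l < j} * c (insert j (f ` G))) = kdiff n c (f ` G)"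
      unfolding kdiff_def using n(1) c by (intro sum.mono_neutral_left) auto
    finally show ?thesis using True by (simp add: relabel_def)
  qed
qed

text \<open>A cycle is pulled back along f and filled there; the filling is pulled back along the
  inverse, which is again increasing.\<close>

lemma exact_at_relabel:
  assumes f: "bij_betw f V' V" "strict_mono_on V' f" and n: "V \<subseteq> {..<n}" "V' \<subseteq> {..<n}"
    and K: "K \<subseteq> Pow V" and ex: "exact_at TYPE('k::field) n {F. F \<subseteq> V' \<and> f ` F \<in> K} i"
  shows "exact_at TYPE('k) n K i"
proof (rule exact_atI)
  let ?K' = "{F. F \<subseteq> V' \<and> f ` F \<in> K}"
  define g where "g = the_inv_into V' f"
  have inj: "inj_on f V'" and im: "f ` V' = V" using f(1) by (auto simp: bij_betw_def)
  have g: "bij_betw g V V'" unfolding g_def by (rule bij_betw_the_inv_into[OF f(1)])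
  have fg: "f (g x) = x" if "x \<in> V" for x
    unfolding g_def using f(1) that by (rule f_the_inv_into_f_bij_betw)
  have gV: "g x \<in> V'" if "x \<in> V" for x using g that by (auto simp: bij_betw_def)
  have gmono: "strict_mono_on V g"
    using strict_mono_on_less[OF f(2) gV gV] fg by (auto intro!: strict_mono_onI)
  have fgF: "f ` g ` F = F" if "F \<subseteq> V" for F
    using fg that by (force simp: image_image)
  fix c :: "nat set \<Rightarrow> 'k" assume c: "c \<in> cplx_chains K i" "kdiff n c = 0"
  have c0: "c F = 0" if "\<not> F \<subseteq> V" for F using c(1) K that by (auto simp: cplx_chains_def)
  have "relabel f V' c \<in> cplx_chains ?K' i"
    unfolding cplx_chains_def
  proof (intro CollectI allI impI)
    fix F assume F: "\<not> (F \<in> ?K' \<and> card F = i)"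
    have "card (f ` F) = card F" if "F \<subseteq> V'"
      using inj_on_subset[OF inj that] by (rule card_image)
    then show "relabel f V' c F = 0" using F c(1) by (auto simp: relabel_def cplx_chains_def)
  qed
  moreover have "kdiff n (relabel f V' c) = 0"
    using kdiff_relabel[of f V' V n c, OF f n c0] unfolding c(2)
    by (simp add: relabel_def zero_fun_def)
  ultimately obtain b where b: "b \<in> cplx_chains ?K' (Suc i)" "kdiff n b = relabel f V' c"
    using exact_atD[OF ex] by blast
  have b0: "b F = 0" if "\<not> F \<subseteq> V'" for F using b(1) that by (auto simp: cplx_chains_def)
  have "kdiff n (relabel g V b) = relabel g V (relabel f V' c)"
    using kdiff_relabel[of g V V' n b, OF g gmono n(2) n(1) b0] unfolding b(2) .
  also have "\<dots> = c"
  proof (rule ext)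
    fix F show "relabel g V (relabel f V' c) F = c F"
      using fgF[of F] gV c0[of F] by (auto simp: relabel_def)
  qed
  finally have "kdiff n (relabel g V b) = c" .
  moreover have "relabel g V b \<in> cplx_chains K (Suc i)"
    unfolding cplx_chains_def
  proof (intro CollectI allI impI)
    fix F assume F: "\<not> (F \<in> K \<and> card F = Suc i)"
    have "inj_on g V" using g by (simp add: bij_betw_def)
    then have "card (g ` F) = card F" if "F \<subseteq> V" using that by (metis card_image inj_on_subset)
    then show "relabel g V b F = 0" using F b(1) fgF[of F] by (auto simp: relabel_def cplx_chains_def)
  qed
  ultimately show "\<exists>b\<in>cplx_chains K (Suc i). kdiff n b = c" by blast
qed

section \<open>Complexes symmetric in a block of vertices\<close>

text \<open>Here \<open>P u\<close> is an increasing family of complexes on \<open>U\<close>. The parameter \<open>a\<close> is needed because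
  deleting a vertex of \<open>B\<close> raises it by one, while passing to the link leaves it unchanged.\<close>

definition stair :: "(nat \<Rightarrow> nat set \<Rightarrow> bool) \<Rightarrow> nat set \<Rightarrow> nat set \<Rightarrow> nat \<Rightarrow> nat set set" where
  "stair P U B a = {F. F \<subseteq> U \<union> B \<and> P (card B + a - card (F \<inter> B)) (F \<inter> U)}"

text \<open>Bookkeeping for c steps, b of them deletions, each raising the parameter, and
  \<open>c - b\<close> of them links, each lowering the degree. The first step is of one kind or the
  other. The equation \<open>k + c = i + b\<close> avoids truncated subtraction.\<close>

lemma stair_index:
  fixes a c i :: nat
  shows "(\<exists>b k. b \<le> c \<and> k + c = i + b \<and> h (Suc a + b) k) \<or>
    (\<exists>i'. i = Suc i' \<and> (\<exists>b k. b \<le> c \<and> k + c = i' + b \<and> h (a + b) k)) \<longleftrightarrow>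
    (\<exists>b k. b \<le> Suc c \<and> k + Suc c = i + b \<and> h (a + b) k)"
    (is "?l1 \<or> ?l2 \<longleftrightarrow> ?r")
proof
  assume "?l1 \<or> ?l2"
  then show ?r
  proof (elim disjE exE conjE)
    fix b k assume "b \<le> c" "k + c = i + b" "h (Suc a + b) k"
    then show ?r by (intro exI[of _ "Suc b"] exI[of _ k]) simp
  next
    fix i' b k assume "i = Suc i'" "b \<le> c" "k + c = i' + b" "h (a + b) k"
    then show ?r by (intro exI[of _ b] exI[of _ k]) simp
  qed
next
  assume ?r
  then obtain b k where bk: "b \<le> Suc c" "k + Suc c = i + b" "h (a + b) k" by blast
  show "?l1 \<or> ?l2"
  proof (cases b)
    case 0
    then have ?l2 using bk by (intro exI[of _ "i - 1"] exI[of _ 0] exI[of _ k] conjI) simp_all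
    then show ?thesis ..
  next
    case (Suc b')
    then have ?l1 using bk by (intro exI[of _ b'] exI[of _ k]) simp
    then show ?thesis ..
  qed
qed

text \<open>The vertices of B are removed one at a time by \<open>exact_at_del_link\<close>, with w
  as the apex each time. In the result b counts the deletions among these steps.\<close>

lemma exact_at_stair:
  assumes mono: "\<And>u u' F. u \<le> u' \<Longrightarrow> P u F \<Longrightarrow> P u' F"
    and "finite U" "finite B" "U \<inter> insert w B = {}" "w \<notin> B" "U \<union> insert w B \<subseteq> {..<n}"
  shows "\<not> exact_at TYPE('k::field) n (stair P U (insert w B) a) i \<longleftrightarrow>
    (\<exists>b k. b \<le> card B \<and> k + card B = i + b \<and> \<not> exact_at TYPE('k) n (stair P U {w} (a + b)) k)"
  using assms(3-)
proof (induction B arbitrary: a i rule: finite_induct)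
  case empty
  then show ?case by simp
next
  case (insert v B)
  let ?B = "insert w B"
  let ?K = "stair P U (insert w (insert v B)) a"
  have vw: "v \<noteq> w" "v \<notin> ?B" "v \<notin> U" "w \<notin> U" and finB: "finite ?B"
    using insert.hyps insert.prems by auto
  have B': "insert w (insert v B) = insert v ?B" by auto
  have cB: "card (insert v ?B) = Suc (card ?B)" using vw finB by simp
  have le: "card (F \<inter> ?B) \<le> card ?B" for F using finB by (intro card_mono) auto
  have del: "del v ?K = stair P U ?B (Suc a)"
  proof -
    have "F \<inter> insert v ?B = F \<inter> ?B" "F \<subseteq> U \<union> insert v ?B \<longleftrightarrow> F \<subseteq> U \<union> ?B" if "v \<notin> F" for F
      using that by blast+
    moreover have "v \<notin> F" if "F \<subseteq> U \<union> ?B" for F using that vw by blast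
    ultimately show ?thesis unfolding B' del_def stair_def cB by (auto simp del: insert_iff Int_insert_right)
  qed
  have link: "link v ?K = stair P U ?B a"
  proof -
    have 1: "insert v F \<inter> insert v ?B = insert v (F \<inter> ?B)" "insert v F \<inter> U = F \<inter> U" for F
      using vw by auto
    have 2: "card (insert v (F \<inter> ?B)) = Suc (card (F \<inter> ?B))" for F
      using vw finB by (subst card_insert_disjoint) auto
    have 3: "v \<notin> F \<and> insert v F \<subseteq> U \<union> insert v ?B \<longleftrightarrow> F \<subseteq> U \<union> ?B" for F using vw by blast
    show ?thesis unfolding B' link_def stair_def mem_Collect_eq 1 2 cB conj_assoc[symmetric] 3
      by simp
  qed
  have step: "exact_at TYPE('k) n ?K i \<longleftrightarrow> exact_at TYPE('k) n (stair P U ?B (Suc a)) i \<and>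
      (\<forall>k. i = Suc k \<longrightarrow> exact_at TYPE('k) n (stair P U ?B a) k)"
    unfolding del[symmetric] link[symmetric]
  proof (rule exact_at_del_link)
    show "v < n" "w < n" using insert.prems by auto
    show "finite F" if "F \<in> ?K" for F
    proof (rule finite_subset)
      show "F \<subseteq> U \<union> insert w (insert v B)" using that by (simp add: stair_def)
      show "finite (U \<union> insert w (insert v B))" using finB assms(2) by simp
    qed
    show "link v ?K \<subseteq> del v ?K"
    proof
      fix F assume "F \<in> link v ?K"
      then have F: "F \<subseteq> U \<union> ?B" "P (card ?B + a - card (F \<inter> ?B)) (F \<inter> U)"
        unfolding link unfolding stair_def by simp_all
      have "P (card ?B + Suc a - card (F \<inter> ?B)) (F \<inter> U)" by (rule mono[OF _ F(2)]) simp
      then show "F \<in> del v ?K" unfolding del unfolding stair_def using F(1) by simp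
    qed
    fix F assume "F \<in> link v ?K"
    then have F: "F \<subseteq> U \<union> ?B" "P (card ?B + a - card (F \<inter> ?B)) (F \<inter> U)"
      unfolding link unfolding stair_def by simp_all
    \<comment> \<open>Coning with w uses up at most one vertex of the block, which the extra unit in
      the parameter of the deletion repays.\<close>
    have 3: "insert w F \<inter> ?B = insert w (F \<inter> ?B)" "insert w F \<inter> U = F \<inter> U" using vw by auto
    have "card (insert w F \<inter> ?B) \<le> Suc (card (F \<inter> ?B))"
      unfolding 3 using finB by (simp add: card_insert_if)
    then have "P (card ?B + Suc a - card (insert w F \<inter> ?B)) (insert w F \<inter> U)"
      unfolding 3(2) by (intro mono[OF _ F(2)]) (use le[of F] in linarith)
    then show "insert w F \<in> del v ?K"
      unfolding del unfolding stair_def using F(1) by simp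
  qed
  have IH: "\<not> exact_at TYPE('k) n (stair P U ?B a') i' \<longleftrightarrow>
    (\<exists>b k. b \<le> card B \<and> k + card B = i' + b \<and> \<not> exact_at TYPE('k) n (stair P U {w} (a' + b)) k)" for a' i'
    by (rule insert.IH) (use insert.prems in auto)
  show ?case
    unfolding card_insert_disjoint[OF insert.hyps] step de_Morgan_conj not_all not_imp IH
    by (rule stair_index[of "card B" i "\<lambda>b k. \<not> exact_at TYPE('k) n (stair P U {w} b) k" a])
qed

text \<open>With or without w the first argument of P is at least a, where P no longer changes, so w
  is an apex.\<close>

lemma exact_at_stair_const:
  assumes P: "\<And>u F. r \<le> u \<Longrightarrow> P u F \<longleftrightarrow> P r F" and "r \<le> a" "finite U" "w \<notin> U" "w < n"
  shows "exact_at TYPE('k::field) n (stair P U {w} a) k"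
proof (rule exact_at_cone)
  fix F assume F: "F \<in> stair P U {w} a"
  show "finite F" using F assms(3) by (auto simp: stair_def intro: finite_subset)
  have *: "card (F \<inter> {w}) \<le> 1" for F :: "nat set" using card_mono[of "{w}" "F \<inter> {w}"] by simp
  have "P (card {w} + a - card (F \<inter> {w})) F' = P r F'" for F F'
    by (rule P) (use *[of F] assms(2) in simp)
  then show "insert w F \<in> stair P U {w} a"
    using F assms(4) unfolding stair_def by simp
qed (rule assms)

text \<open>By \<open>exact_at_stair_const\<close> only base complexes with parameter
  \<open>b < r\<close> contribute, and \<open>r \<le> card B\<close> puts all of these in the range
  already available for B. Enlarging the block to B' adds no new ones and merely moves the
  degree.\<close>

lemma stair_shift:
  assumes mono: "\<And>u u' F. u \<le> u' \<Longrightarrow> P u F \<Longrightarrow> P u' F"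
    and const: "\<And>u F. r \<le> u \<Longrightarrow> P u F \<longleftrightarrow> P r F"
    and "finite U" "finite B'" "U \<inter> B' = {}" "U \<union> B' \<subseteq> {..<n}" "B \<subseteq> B'" "B \<noteq> {}" "r \<le> card B"
  shows "\<not> exact_at TYPE('k::field) n (stair P U B' 0) i' \<longleftrightarrow>
    card B' - card B \<le> i' \<and> \<not> exact_at TYPE('k) n (stair P U B 0) (i' - (card B' - card B))"
proof -
  obtain w where w: "w \<in> B" using assms(8) by auto
  have fin: "finite B" using assms(4,7) finite_subset by auto
  have c: "card B = Suc (card (B - {w}))" "card B' = Suc (card (B' - {w}))"
    using card_Suc_Diff1[OF fin w] card_Suc_Diff1[OF assms(4) subsetD[OF assms(7) w]] by simp_all
  have le: "card B \<le> card B'" using assms(4,7) by (rule card_mono)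
  let ?e = "\<lambda>b k. \<not> exact_at TYPE('k) n (stair P U {w} b) k"
  have small: "b < r" if "?e b k" for b k
  proof (rule ccontr)
    assume "\<not> b < r"
    then have rb: "r \<le> b" by simp
    have wU: "w \<notin> U" "w < n" using w assms(5-7) by blast+
    have "exact_at TYPE('k) n (stair P U {w} b) k"
      by (rule exact_at_stair_const[of r P, OF const rb assms(3) wU])
    then show False using that by simp
  qed
  \<comment> \<open>Both blocks are reduced to the same vertex w of B, so the same base complexes
    appear on both sides.\<close>
  have *: "\<not> exact_at TYPE('k) n (stair P U C 0) i \<longleftrightarrow>
     (\<exists>b k. b \<le> card (C - {w}) \<and> k + card (C - {w}) = i + b \<and> ?e b k)"
    if C: "w \<in> C" "C \<subseteq> B'" for C i
  proof -
    have "insert w (C - {w}) = C" using C by blast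
    moreover have "finite (C - {w})" using C assms(4) finite_subset by auto
    moreover have "U \<inter> C = {}" "U \<union> C \<subseteq> {..<n}" using C assms(5,6) by blast+
    ultimately show ?thesis
      using exact_at_stair[of P U "C - {w}" w n 0 i, where 'k='k, OF mono assms(3)] by simp
  qed
  note B = *[OF w assms(7)] and B' = *[OF subsetD[OF assms(7) w] subset_refl]
  show ?thesis unfolding B B'
  proof (intro iffI; (elim exE conjE)?)
    fix b k assume h: "b \<le> card (B' - {w})" "k + card (B' - {w}) = i' + b" "?e b k"
    show "card B' - card B \<le> i' \<and> (\<exists>b k. b \<le> card (B - {w}) \<and>
        k + card (B - {w}) = i' - (card B' - card B) + b \<and> ?e b k)"
      using h small[OF h(3)] c le assms(9) by (intro conjI exI[of _ b] exI[of _ k]) linarith+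
  next
    fix b k assume h: "card B' - card B \<le> i'" "b \<le> card (B - {w})"
      "k + card (B - {w}) = i' - (card B' - card B) + b" "?e b k"
    show "\<exists>b k. b \<le> card (B' - {w}) \<and> k + card (B' - {w}) = i' + b \<and> ?e b k"
      using h c le by (intro exI[of _ b] exI[of _ k] conjI) linarith+
  qed
qed

section \<open>Betti numbers and exactness\<close>

lemma vector_space_fscale: "vector_space (fscale :: 'k::field \<Rightarrow> (nat set \<Rightarrow> 'k) \<Rightarrow> _)"
  by unfold_locales (auto simp: fscale_def fun_eq_iff algebra_simps)

text \<open>Supplies finite dimensionality: the space of all functions on vertex sets is
  infinite-dimensional, and \<open>dim\<close> is informative only below a finite spanning
  set.\<close>

lemma cplx_chains_span:
  fixes K :: "nat set set"
  assumes "finite K"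
  shows "(cplx_chains K i :: (nat set \<Rightarrow> 'k::field) set) \<subseteq>
    module.span fscale ((\<lambda>F G. if G = F then 1 else 0) ` K)"
proof
  interpret vector_space "fscale :: 'k \<Rightarrow> (nat set \<Rightarrow> 'k) \<Rightarrow> _" by (rule vector_space_fscale)
  let ?d = "\<lambda>F G. if G = F then 1 else 0 :: 'k"
  have app: "(\<Sum>x\<in>A. f x) y = (\<Sum>x\<in>A. f x y)" if "finite A" for A and f :: "nat set \<Rightarrow> nat set \<Rightarrow> 'k" and y
    using that by induction auto
  fix c :: "nat set \<Rightarrow> 'k" assume c: "c \<in> cplx_chains K i"
  have "c = (\<Sum>F\<in>K. fscale (c F) (?d F))"
  proof (rule ext)
    fix G
    have "(\<Sum>F\<in>K. fscale (c F) (?d F)) G = (\<Sum>F\<in>K. if G = F then c F else 0)"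
      using app[OF assms] by (auto simp: fscale_def intro: sum.cong)
    also have "\<dots> = c G" using assms c by (auto simp: cplx_chains_def sum.delta)
    finally show "c G = (\<Sum>F\<in>K. fscale (c F) (?d F)) G" by simp
  qed
  moreover have "(\<Sum>F\<in>K. fscale (c F) (?d F)) \<in> span (?d ` K)"
    by (intro span_sum span_scale span_base) auto
  ultimately show "c \<in> span (?d ` K)" by simp
qed

text \<open>The subtraction is truncated, so nonzero means that the boundaries have strictly smaller
  dimension. For nested finite-dimensional subspaces this is proper inclusion.\<close>

lemma homology_dim_nonzero_iff:
  assumes "finite K" and down: "\<And>F j. F \<in> K \<Longrightarrow> j \<in> F \<Longrightarrow> F - {j} \<in> K" and fin: "\<And>F. F \<in> K \<Longrightarrow> finite F"
  shows "vector_space.dim (fscale :: 'k::field \<Rightarrow> _) {c \<in> cplx_chains K i. kdiff n c = 0}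
    - vector_space.dim (fscale :: 'k \<Rightarrow> _) (kdiff n ` cplx_chains K (Suc i)) \<noteq> 0
    \<longleftrightarrow> \<not> exact_at TYPE('k) n K i"
proof -
  interpret vector_space "fscale :: 'k \<Rightarrow> (nat set \<Rightarrow> 'k) \<Rightarrow> _" by (rule vector_space_fscale)
  let ?Z = "{c \<in> cplx_chains K i. kdiff n c = 0} :: (nat set \<Rightarrow> 'k) set"
  let ?B = "kdiff n ` cplx_chains K (Suc i) :: (nat set \<Rightarrow> 'k) set"
  obtain S :: "(nat set \<Rightarrow> 'k) set" where S: "finite S" "\<And>i. cplx_chains K i \<subseteq> span S"
    using that[OF finite_imageI[OF assms(1)] cplx_chains_span[OF assms(1)]] .
  \<comment> \<open>Closure of K under removing an element keeps boundaries supported on K.\<close>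
  have BZ: "?B \<subseteq> ?Z"
  proof
    fix x assume "x \<in> ?B"
    then obtain b where b: "b \<in> cplx_chains K (Suc i)" "x = kdiff n b" by auto
    have "x \<in> cplx_chains K i"
      unfolding cplx_chains_def
    proof (intro CollectI allI impI)
      fix F assume F: "\<not> (F \<in> K \<and> card F = i)"
      have "b (insert j F) = 0" if "j \<notin> F" for j
      proof (rule ccontr)
        assume "b (insert j F) \<noteq> 0"
        then have "insert j F \<in> K" "card (insert j F) = Suc i" using b(1) unfolding cplx_chains_def by blast+
        moreover from this have "finite F" using fin[of "insert j F"] by simp
        ultimately show False using F down[of "insert j F" j] that by auto
      qed
      then show "x F = 0" unfolding b(2) kdiff_def by (intro sum.neutral) auto
    qed
    then show "x \<in> ?Z" using b by (simp add: kdiff_kdiff)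
  qed
  have ZS: "?Z \<subseteq> span S" using S(2) by blast
  have sub: "subspace ?B"
    unfolding subspace_def
  proof (intro conjI ballI allI)
    have "0 \<in> cplx_chains K (Suc i)" by (simp add: cplx_chains_def)
    then show "0 \<in> ?B" using imageI[of 0 "cplx_chains K (Suc i)" "kdiff n"] by (simp add: kdiff_zero)
    fix x y assume "x \<in> ?B" "y \<in> ?B"
    then obtain b c where bc: "b \<in> cplx_chains K (Suc i)" "c \<in> cplx_chains K (Suc i)" "x = kdiff n b" "y = kdiff n c"
      by auto
    show "x + y \<in> ?B" unfolding bc(3,4) kdiff_add[symmetric] using cplx_chains_add[OF bc(1,2)] by (rule imageI)
  next
    fix a x assume "x \<in> ?B"
    then obtain b where b: "b \<in> cplx_chains K (Suc i)" "x = kdiff n b" by auto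
    have "fscale a b \<in> cplx_chains K (Suc i)" using b(1) by (simp add: cplx_chains_def fscale_def)
    then show "fscale a x \<in> ?B" unfolding b(2) kdiff_fscale[symmetric] by (rule imageI)
  qed
  obtain A where A: "A \<subseteq> ?B" "independent A" "?B \<subseteq> span A" "card A = dim ?B" by (rule basis_exists)
  obtain C where C: "C \<subseteq> ?Z" "independent C" "?Z \<subseteq> span C" "card C = dim ?Z" by (rule basis_exists)
  have finC: "finite C" using independent_span_bound[OF S(1) C(2)] C(1) ZS by blast
  have finA: "finite A" using independent_span_bound[OF finC A(2)] A(1) BZ C(3) by blast
  show ?thesis
  proof
    assume "dim ?Z - dim ?B \<noteq> 0"
    moreover have "dim ?Z \<le> dim ?B" if "?Z \<subseteq> ?B"
      using dim_le_card[OF subset_trans[OF that A(3)] finA] A(4) by simp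
    ultimately have "\<not> ?Z \<subseteq> ?B" by auto
    then show "\<not> exact_at TYPE('k) n K i" unfolding exact_at_def by blast
  next
    assume "\<not> exact_at TYPE('k) n K i"
    then obtain x where x: "x \<in> ?Z" "x \<notin> ?B" unfolding exact_at_def by blast
    \<comment> \<open>A cycle that is not a boundary enlarges a basis of the boundaries to a larger
      independent set of cycles.\<close>
    have "x \<notin> span A" using x(2) span_minimal[OF A(1) sub] by blast
    then have ind: "independent (insert x A)" and "x \<notin> A"
      using independent_insertI[OF _ A(2)] span_base by blast+
    have "insert x A \<subseteq> span C" using x(1) A(1) BZ C(3) by blast
    then have "card (insert x A) \<le> card C" using independent_span_bound[OF finC ind] by blast
    then show "dim ?Z - dim ?B \<noteq> 0" using finA \<open>x \<notin> A\<close> A(4) C(4) by simp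
  qed
qed

section \<open>Membership in symmetric monomial ideals\<close>

text \<open>For \<open>t > 0\<close> this is the t-th part of the conjugate partition.\<close>

definition npart :: "nat list \<Rightarrow> nat \<Rightarrow> nat" where
  "npart lam t = card {k. k < length lam \<and> t \<le> lam ! k}"

lemma npart_le_length: "npart lam t \<le> length lam"
proof -
  have "card {k. k < length lam \<and> t \<le> lam ! k} \<le> card {..<length lam}" by (intro card_mono) auto
  then show ?thesis by (simp add: npart_def)
qed

lemma finite_level: "supp_in n a \<Longrightarrow> 0 < t \<Longrightarrow> finite {j. t \<le> a j}"
  by (rule finite_subset[of _ "{..<n}"], rule subsetI, rule ccontr) (auto simp: supp_in_def)

text \<open>Parts are placed in decreasing order. For the part with index k at least
  \<open>k + 1\<close> positions are large enough, and only k of them are taken.\<close>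

lemma greedy_injection:
  assumes "is_partition lam" and cnt: "\<And>t. 0 < t \<Longrightarrow> npart lam t \<le> card {j. t \<le> a j}"
    and k: "k \<le> length lam"
  shows "\<exists>f. inj_on f {..<k} \<and> (\<forall>i<k. lam ! i \<le> a (f i))"
  using k
proof (induction k)
  case (Suc k)
  then obtain f where f: "inj_on f {..<k}" "\<forall>i<k. lam ! i \<le> a (f i)" by auto
  let ?t = "lam ! k"
  have t: "0 < ?t" using assms(1) Suc.prems by (auto simp: is_partition_def)
  have dec: "?t \<le> lam ! i" if "i \<le> k" for i
    using assms(1) Suc.prems that sorted_rev_nth_mono[of lam i k] by (auto simp: is_partition_def)
  have "{..k} \<subseteq> {i. i < length lam \<and> ?t \<le> lam ! i}" using dec Suc.prems by auto
  then have "Suc k \<le> npart lam ?t" unfolding npart_def using card_mono[of "{i. i < length lam \<and> ?t \<le> lam ! i}" "{..k}"] by simp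
  also have "\<dots> \<le> card {j. ?t \<le> a j}" by (rule cnt[OF t])
  finally have "card (f ` {..<k}) < card {j. ?t \<le> a j}"
    using card_image_le[of "{..<k}" f] by simp
  then obtain j where j: "?t \<le> a j" "j \<notin> f ` {..<k}"
    by (metis (mono_tags, lifting) card_mono finite_imageI finite_lessThan mem_Collect_eq not_less subsetI)
  have "inj_on (f(k := j)) {..<Suc k}"
    using f(1) j(2) by (auto simp: inj_on_def lessThan_Suc)
  moreover have "\<forall>i<Suc k. lam ! i \<le> a ((f(k := j)) i)" using f(2) j(1) by (auto simp: less_Suc_eq)
  ultimately show ?case by blast
qed simp

text \<open>Inside a common \<open>{..<N}\<close> the complements of domain and image have equal
  size, and any bijection between them completes f.\<close>

lemma extend_inj_permutes:
  fixes f :: "nat \<Rightarrow> nat"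
  assumes "inj_on f {..<l}"
  obtains \<sigma> N where "\<sigma> permutes {..<N}" "\<And>i. i < l \<Longrightarrow> \<sigma> i = f i"
proof -
  have "finite ({..<l} \<union> f ` {..<l})" by simp
  then obtain N where N: "\<forall>x \<in> {..<l} \<union> f ` {..<l}. x < N"
    using finite_nat_set_iff_bounded by blast
  let ?A = "{..<l}" and ?S = "{..<N}"
  have sub: "?A \<subseteq> ?S" "f ` ?A \<subseteq> ?S"
    by (rule subsetI, use N in simp)+
  have "card (?S - ?A) = card (?S - f ` ?A)"
    using card_Diff_subset[OF _ sub(1)] card_Diff_subset[OF _ sub(2)] card_image[OF assms] by simp
  then obtain g where g: "bij_betw g (?S - ?A) (?S - f ` ?A)"
    using finite_same_card_bij[of "?S - ?A" "?S - f ` ?A"] by blast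
  define h where "h x = (if x \<in> ?A then f x else g x)" for x
  have hA: "h ` ?A = f ` ?A" by (simp add: h_def)
  have hS: "bij_betw h (?S - ?A) (?S - f ` ?A)"
    using g bij_betw_cong[of "?S - ?A" h g "?S - f ` ?A"] by (simp add: h_def)
  have "bij_betw h ?A (f ` ?A)"
    using assms hA by (simp add: bij_betw_def h_def inj_on_def)
  then have "bij_betw h (?A \<union> (?S - ?A)) (f ` ?A \<union> (?S - f ` ?A))"
    using hS by (rule bij_betw_combine) blast
  then have h: "bij_betw h ?S ?S" using sub by (simp only: Un_Diff_cancel Un_absorb1)
  define \<sigma> where "\<sigma> x = (if x \<in> ?S then h x else x)" for x
  have "bij_betw \<sigma> ?S ?S"
    using h bij_betw_cong[of ?S \<sigma> h ?S] by (simp add: \<sigma>_def)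
  then have "\<sigma> permutes ?S"
    by (rule bij_imp_permutes) (simp add: \<sigma>_def)
  moreover have "\<sigma> i = f i" if "i < l" for i
    using that sub(1) by (auto simp: \<sigma>_def h_def)
  ultimately show ?thesis using that[of \<sigma> N] by simp
qed

text \<open>The threshold \<open>t = 0\<close> is excluded because there \<open>{j. t \<le> a j}\<close> is infinite and has \<open>card\<close> 0.\<close>

lemma mem_sym_mon_ideal_iff:
  assumes "\<forall>lam\<in>G. is_partition lam"
  shows "a \<in> sym_mon_ideal G \<longleftrightarrow> (\<exists>n. supp_in n a) \<and>
    (\<exists>lam\<in>G. \<forall>t>0. npart lam t \<le> card {j. t \<le> a j})"
proof (cases "\<exists>n. supp_in n a")
  case True
  then obtain n where n: "supp_in n a" by blast
  have "(\<exists>\<sigma> N. \<sigma> permutes {..<N::nat} \<and> (\<forall>k. pexp lam k \<le> a (\<sigma> k))) \<longleftrightarrow>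
     (\<forall>t>0. npart lam t \<le> card {j. t \<le> a j})" if "lam \<in> G" for lam
  proof
    assume "\<exists>\<sigma> N. \<sigma> permutes {..<N::nat} \<and> (\<forall>k. pexp lam k \<le> a (\<sigma> k))"
    then obtain \<sigma> N where s: "\<sigma> permutes {..<N::nat}" "\<And>k. pexp lam k \<le> a (\<sigma> k)" by blast
    show "\<forall>t>0. npart lam t \<le> card {j. t \<le> a j}"
    proof (intro allI impI)
      fix t :: nat assume t: "0 < t"
      let ?L = "{k. k < length lam \<and> t \<le> lam ! k}"
      have "inj_on \<sigma> ?L" using permutes_inj[OF s(1)] by (rule inj_on_subset) simp
      then have "npart lam t = card (\<sigma> ` ?L)" by (simp add: npart_def card_image)
      also have "\<dots> \<le> card {j. t \<le> a j}"
      proof (rule card_mono[OF finite_level[OF n t]])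
        show "\<sigma> ` ?L \<subseteq> {j. t \<le> a j}"
        proof (intro subsetI CollectI)
          fix j assume "j \<in> \<sigma> ` ?L"
          then obtain k where "k < length lam" "t \<le> lam ! k" "j = \<sigma> k" by auto
          then show "t \<le> a j" using s(2)[of k] by (simp add: pexp_def)
        qed
      qed
      finally show "npart lam t \<le> card {j. t \<le> a j}" .
    qed
  next
    assume "\<forall>t>0. npart lam t \<le> card {j. t \<le> a j}"
    then obtain f where f: "inj_on f {..<length lam}" "\<forall>i<length lam. lam ! i \<le> a (f i)"
      using greedy_injection[of lam a "length lam"] bspec[OF assms \<open>lam \<in> G\<close>] by blast
    obtain \<sigma> N where "\<sigma> permutes {..<N}" "\<And>i. i < length lam \<Longrightarrow> \<sigma> i = f i"
      by (rule extend_inj_permutes[OF f(1)]) blast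
    then show "\<exists>\<sigma> N. \<sigma> permutes {..<N::nat} \<and> (\<forall>k. pexp lam k \<le> a (\<sigma> k))"
      using f(2) by (intro exI[of _ \<sigma>] exI[of _ N]) (simp add: pexp_def)
  qed
  then show ?thesis using True unfolding sym_mon_ideal_def mem_Collect_eq
    by (intro conj_cong bex_cong refl)
qed (simp add: sym_mon_ideal_def)

section \<open>Upper Koszul complexes\<close>

definition red :: "(nat \<Rightarrow> nat) \<Rightarrow> nat set \<Rightarrow> nat \<Rightarrow> nat" where
  "red \<alpha> F = (\<lambda>j. \<alpha> j - (if j \<in> F then 1 else 0))"

text \<open>The upper Koszul simplicial complex in degree \<alpha>. It is formed with the ideal in
  infinitely many variables, so n enters only through \<open>exact_at\<close>.\<close>

definition koszul :: "nat list set \<Rightarrow> (nat \<Rightarrow> nat) \<Rightarrow> nat set set" where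
  "koszul G \<alpha> = {F. F \<subseteq> {j. 0 < \<alpha> j} \<and> red \<alpha> F \<in> sym_mon_ideal G}"

lemma supp_in_red: "supp_in n \<alpha> \<Longrightarrow> supp_in n (red \<alpha> F)"
  by (simp add: supp_in_def red_def)

lemma supp_in_subset: "supp_in n \<alpha> \<Longrightarrow> {j. 0 < \<alpha> j} \<subseteq> {..<n}"
  by (rule subsetI, rule ccontr) (simp add: supp_in_def)

lemma supp_in_mono: "supp_in n \<alpha> \<Longrightarrow> n \<le> n' \<Longrightarrow> supp_in n' \<alpha>"
  by (simp add: supp_in_def)

context
  fixes G :: "nat list set" and m :: nat
  assumes finG: "finite G" and partG: "\<forall>lam\<in>G. is_partition lam \<and> length lam \<le> m" and m: "1 \<le> m"
begin

lemma npart_le: "lam \<in> G \<Longrightarrow> npart lam t \<le> m"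
  by (rule order_trans[OF npart_le_length]) (use partG in blast)

lemma koszul_iff:
  assumes "supp_in n \<alpha>"
  shows "F \<in> koszul G \<alpha> \<longleftrightarrow> F \<subseteq> {j. 0 < \<alpha> j} \<and>
     (\<exists>lam\<in>G. \<forall>t>0. npart lam t \<le> card {j. t \<le> red \<alpha> F j})"
proof -
  have "\<forall>lam\<in>G. is_partition lam" using partG by blast
  from mem_sym_mon_ideal_iff[OF this] show ?thesis
    using supp_in_red[OF assms] unfolding koszul_def by blast
qed

lemma koszul_Pow: "supp_in n \<alpha> \<Longrightarrow> koszul G \<alpha> \<subseteq> Pow {..<n}"
  using supp_in_subset[of n \<alpha>] unfolding koszul_def by auto

lemma koszul_finite: "supp_in n \<alpha> \<Longrightarrow> F \<in> koszul G \<alpha> \<Longrightarrow> finite F"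
  using koszul_Pow[of n \<alpha>] by (auto intro: finite_subset[OF _ finite_lessThan])

lemma koszul_down:
  assumes "supp_in n \<alpha>" "F \<in> koszul G \<alpha>" "F' \<subseteq> F"
  shows "F' \<in> koszul G \<alpha>"
proof -
  obtain lam where lam: "lam \<in> G" "\<And>t. 0 < t \<Longrightarrow> npart lam t \<le> card {j. t \<le> red \<alpha> F j}"
    using assms(2) koszul_iff[OF assms(1)] by blast
  have "npart lam t \<le> card {j. t \<le> red \<alpha> F' j}" if "0 < t" for t
  proof -
    have "red \<alpha> F j \<le> red \<alpha> F' j" for j using assms(3) by (auto simp: red_def)
    then have "{j. t \<le> red \<alpha> F j} \<subseteq> {j. t \<le> red \<alpha> F' j}" using order_trans by blast
    then have "card {j. t \<le> red \<alpha> F j} \<le> card {j. t \<le> red \<alpha> F' j}"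
      by (rule card_mono[OF finite_level[OF supp_in_red[OF assms(1)] that]])
    then show ?thesis using lam(2)[OF that] by simp
  qed
  moreover have "F' \<subseteq> {j. 0 < \<alpha> j}" using assms(2,3) by (auto simp: koszul_def)
  ultimately show ?thesis using lam(1) koszul_iff[OF assms(1)] by blast
qed

text \<open>The strand of the Koszul complex in multidegree \<alpha> is the chain complex of
  \<open>koszul G \<alpha>\<close>.\<close>

lemma betti_mdeg_nonzero_iff:
  assumes "supp_in n \<alpha>"
  shows "betti_mdeg TYPE('k::field) (restr_ideal G n) n \<alpha> i \<noteq> 0 \<longleftrightarrow>
    \<not> exact_at TYPE('k) n (koszul G \<alpha>) i"
proof -
  have kb: "kbasis (restr_ideal G n) n \<alpha> i = {F \<in> koszul G \<alpha>. card F = i}" for i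
    using supp_in_red[OF assms] koszul_Pow[OF assms]
    unfolding kbasis_def restr_ideal_def koszul_def red_def by (auto simp: Suc_le_eq)
  have kc: "kchains (restr_ideal G n) n \<alpha> i = (cplx_chains (koszul G \<alpha>) i :: (nat set \<Rightarrow> 'k) set)" for i
    unfolding kchains_def cplx_chains_def kb by simp
  have "finite (koszul G \<alpha>)" using koszul_Pow[OF assms] by (rule finite_subset) simp
  then show ?thesis
    unfolding betti_mdeg_def kc
    by (rule homology_dim_nonzero_iff) (use koszul_down[OF assms] koszul_finite[OF assms] in blast)+
qed

lemma betti_nonzero_iff:
  "betti TYPE('k::field) (restr_ideal G n) n i j \<noteq> 0 \<longleftrightarrow> 0 \<le> i \<and> 0 \<le> j \<and>
    (\<exists>\<alpha>. supp_in n \<alpha> \<and> (\<Sum>l<n. \<alpha> l) = nat j \<and> \<not> exact_at TYPE('k) n (koszul G \<alpha>) (nat i))"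
proof -
  let ?S = "{\<alpha>. supp_in n \<alpha> \<and> (\<Sum>l<n. \<alpha> l) = nat j}"
  \<comment> \<open>Finiteness matters, as a sum over an infinite set defaults to zero: exponents
    are bounded by the total degree and vanish from n on.\<close>
  have "?S \<subseteq> {f. \<forall>x. (x \<in> {..<n} \<longrightarrow> f x \<in> {..nat j}) \<and> (x \<notin> {..<n} \<longrightarrow> f x = 0)}"
  proof (intro subsetI CollectI allI conjI impI)
    fix \<alpha> x assume a: "\<alpha> \<in> ?S"
    show "\<alpha> x \<in> {..nat j}" if "x \<in> {..<n}"
      using a member_le_sum[OF that, of \<alpha>] by simp
    show "\<alpha> x = 0" if "x \<notin> {..<n}" using a that by (simp add: supp_in_def)
  qed
  then have fin: "finite ?S" by (rule finite_subset) (rule finite_set_of_finite_funs, auto)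
  show ?thesis
  proof (cases "i < 0 \<or> j < 0")
    case False
    then have "betti TYPE('k) (restr_ideal G n) n i j \<noteq> 0 \<longleftrightarrow>
        (\<exists>\<alpha>\<in>?S. betti_mdeg TYPE('k) (restr_ideal G n) n \<alpha> (nat i) \<noteq> 0)"
      using sum_eq_0_iff[OF fin, of "\<lambda>\<alpha>. betti_mdeg TYPE('k) (restr_ideal G n) n \<alpha> (nat i)"]
      by (simp add: betti_def)
    also have "\<dots> \<longleftrightarrow> (\<exists>\<alpha>\<in>?S. \<not> exact_at TYPE('k) n (koszul G \<alpha>) (nat i))"
      by (intro bex_cong refl) (auto simp only: mem_Collect_eq betti_mdeg_nonzero_iff)
    finally show ?thesis using False by simp
  qed (auto simp: betti_def)
qed

text \<open>Lowering the exponent at \<open>j\<close> changes only the count at the threshold \<open>\<alpha> j\<close>, which \<open>vac\<close> makes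
  irrelevant.\<close>

lemma koszul_cone:
  assumes a: "supp_in n \<alpha>" and j: "0 < \<alpha> j"
    and vac: "m \<le> card {i. \<alpha> j < \<alpha> i} \<or> (\<forall>lam\<in>G. npart lam (\<alpha> j) = 0)"
  shows "exact_at TYPE('k::field) n (koszul G \<alpha>) i"
proof (rule exact_at_cone[of j])
  show "j < n" using supp_in_subset[OF a] j by blast
  show "finite F" if "F \<in> koszul G \<alpha>" for F using koszul_finite[OF a that] .
  fix F assume F: "F \<in> koszul G \<alpha>"
  show "insert j F \<in> koszul G \<alpha>"
  proof (cases "j \<in> F")
    case False
    obtain lam where lam: "lam \<in> G" "\<And>t. 0 < t \<Longrightarrow> npart lam t \<le> card {i. t \<le> red \<alpha> F i}"
      using F koszul_iff[OF a] by blast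
    have "npart lam t \<le> card {i. t \<le> red \<alpha> (insert j F) i}" if t: "0 < t" for t
    proof (cases "t = \<alpha> j")
      case True
      \<comment> \<open>Exponents above \<open>\<alpha> j\<close> still reach
        \<open>\<alpha> j\<close> after being lowered by one.\<close>
      have "{i. \<alpha> j < \<alpha> i} \<subseteq> {i. t \<le> red \<alpha> (insert j F) i}" using True by (auto simp: red_def)
      then have "card {i. \<alpha> j < \<alpha> i} \<le> card {i. t \<le> red \<alpha> (insert j F) i}"
        by (rule card_mono[OF finite_level[OF supp_in_red[OF a] t]])
      then show ?thesis using vac npart_le[OF lam(1), of t] True lam(1) by auto
    next
      case ne: False
      have "{i. t \<le> red \<alpha> (insert j F) i} = {i. t \<le> red \<alpha> F i}" using ne False by (auto simp: red_def)
      then show ?thesis using lam(2)[OF t] by simp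
    qed
    moreover have "insert j F \<subseteq> {j. 0 < \<alpha> j}" using F j by (auto simp: koszul_def)
    ultimately show ?thesis using lam(1) koszul_iff[OF a] by blast
  qed (use F in \<open>simp add: insert_absorb\<close>)
qed

text \<open>Here u stands for the number of positions left at exponent e. Exponents in U exceed e
  and stay at least e after one reduction, so the count at threshold e is
  \<open>card U + u\<close>.\<close>

definition level :: "(nat \<Rightarrow> nat) \<Rightarrow> nat \<Rightarrow> nat set \<Rightarrow> nat \<Rightarrow> nat set \<Rightarrow> bool" where
  "level \<alpha> e U u F \<longleftrightarrow> (\<exists>lam\<in>G. (\<forall>t>e. npart lam t \<le> card {j\<in>U. t \<le> red \<alpha> F j}) \<and>
     npart lam e \<le> card U + u)"

text \<open>Thresholds fall into three ranges. Above e only U is counted; at e the count is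
  \<open>card U\<close> plus the untouched part of B; below e the whole support still counts, and it
  has at least m elements.\<close>

lemma koszul_eq_stair:
  assumes a: "supp_in n \<alpha>" and e: "0 < e" "\<And>j. \<alpha> j = 0 \<or> e \<le> \<alpha> j"
    and U: "U = {j. e < \<alpha> j}" and B: "B = {j. \<alpha> j = e}" and c: "m \<le> card U + card B"
  shows "koszul G \<alpha> = stair (level \<alpha> e U) U B 0"
proof (rule set_eqI)
  fix F
  have supp: "{j. 0 < \<alpha> j} = U \<union> B"
  proof -
    have "0 < \<alpha> j \<longleftrightarrow> e < \<alpha> j \<or> \<alpha> j = e" for j using e(1) e(2)[of j] by linarith
    then show ?thesis unfolding U B by blast
  qed
  have fin: "finite U" "finite B" using supp_in_subset[OF a] unfolding supp
    by (auto intro: finite_subset[OF _ finite_lessThan])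
  have disj: "U \<inter> B = {}" using U B by auto
  have cnt: "(\<forall>t>0. npart lam t \<le> card {j. t \<le> red \<alpha> F j}) \<longleftrightarrow>
     (\<forall>t>e. npart lam t \<le> card {j\<in>U. t \<le> red \<alpha> (F \<inter> U) j}) \<and> npart lam e \<le> card U + (card B + 0 - card (F \<inter> B))"
    if "lam \<in> G" for lam
  proof -
    have 1: "{j. t \<le> red \<alpha> F j} = {j\<in>U. t \<le> red \<alpha> (F \<inter> U) j}" if "e < t" for t
      using that U by (auto simp: red_def)
    have "{j. e \<le> red \<alpha> F j} = U \<union> (B - F)" using e(1) U B by (auto simp: red_def split: if_splits)
    moreover have "card (U \<union> (B - F)) = card U + card (B - F)"
      using fin disj by (intro card_Un_disjoint) auto
    moreover have "card (B - F) = card B - card (F \<inter> B)"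
      using fin by (simp add: card_Diff_subset_Int Int_commute)
    ultimately have 2: "card {j. e \<le> red \<alpha> F j} = card U + (card B + 0 - card (F \<inter> B))" by simp
    have 3: "npart lam t \<le> card {j. t \<le> red \<alpha> F j}" if "0 < t" "t < e" for t
    proof -
      have "U \<union> B \<subseteq> {j. t \<le> red \<alpha> F j}" using that U B by (auto simp: red_def)
      then have "card (U \<union> B) \<le> card {j. t \<le> red \<alpha> F j}"
        by (rule card_mono[OF finite_level[OF supp_in_red[OF a] that(1)]])
      then show ?thesis using npart_le[OF \<open>lam \<in> G\<close>, of t] c card_Un_disjoint[OF fin disj] by simp
    qed
    show ?thesis
    proof
      assume h: "\<forall>t>0. npart lam t \<le> card {j. t \<le> red \<alpha> F j}"
      have "npart lam t \<le> card {j\<in>U. t \<le> red \<alpha> (F \<inter> U) j}" if "e < t" for t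
        using h[rule_format, of t] e(1) 1[OF that] that by simp
      then show "(\<forall>t>e. npart lam t \<le> card {j\<in>U. t \<le> red \<alpha> (F \<inter> U) j}) \<and>
          npart lam e \<le> card U + (card B + 0 - card (F \<inter> B))"
        using h[rule_format, OF e(1)] 2 by simp
    next
      assume h: "(\<forall>t>e. npart lam t \<le> card {j\<in>U. t \<le> red \<alpha> (F \<inter> U) j}) \<and>
          npart lam e \<le> card U + (card B + 0 - card (F \<inter> B))"
      show "\<forall>t>0. npart lam t \<le> card {j. t \<le> red \<alpha> F j}"
      proof (intro allI impI)
        fix t :: nat assume "0 < t"
        then consider "t < e" | "t = e" | "e < t" by linarith
        then show "npart lam t \<le> card {j. t \<le> red \<alpha> F j}"
          by cases (use 3 \<open>0 < t\<close> 2 1 h in auto)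
      qed
    qed
  qed
  show "F \<in> koszul G \<alpha> \<longleftrightarrow> F \<in> stair (level \<alpha> e U) U B 0"
    unfolding koszul_iff[OF a] stair_def level_def supp mem_Collect_eq
    using cnt by (intro conj_cong bex_cong refl)
qed

section \<open>Comparing degrees that differ in the block of minimal exponents\<close>

lemma level_mono: "u \<le> u' \<Longrightarrow> level \<alpha> e U u F \<Longrightarrow> level \<alpha> e U u' F"
  unfolding level_def by (meson add_left_mono order_trans)

text \<open>No generator has more than m parts, so from \<open>m - card U\<close> on the condition
  at threshold e always holds.\<close>

lemma level_const: "m - card U \<le> u \<Longrightarrow> level \<alpha> e U u F \<longleftrightarrow> level \<alpha> e U (m - card U) F"
proof -
  assume u: "m - card U \<le> u"
  have "npart lam e \<le> card U + u \<and> npart lam e \<le> card U + (m - card U)" if "lam \<in> G" for lam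
    using npart_le[OF that, of e] u by linarith
  then show ?thesis unfolding level_def by (intro bex_cong refl conj_cong) auto
qed

text \<open>Both complexes come from the same family over U and differ only in the block at exponent
  e. \<open>stair_shift\<close> applies with \<open>r = m - card U\<close>, which equals
  \<open>card B\<close> because \<beta> has exactly m nonzero exponents.\<close>

lemma koszul_shift:
  assumes \<alpha>: "supp_in n \<alpha>" and \<beta>: "supp_in n \<beta>" and e: "0 < e"
    "\<And>j. \<alpha> j = 0 \<or> e \<le> \<alpha> j" "\<And>j. \<beta> j = 0 \<or> e \<le> \<beta> j"
    and agree: "\<And>j. 0 < \<beta> j \<Longrightarrow> \<alpha> j = \<beta> j" and new: "\<And>j. \<beta> j = 0 \<Longrightarrow> \<alpha> j \<le> e"
    and card: "card {j. 0 < \<beta> j} = m" and attained: "\<exists>j. \<beta> j = e"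
  shows "\<not> exact_at TYPE('k::field) n (koszul G \<alpha>) i \<longleftrightarrow>
    card {j. 0 < \<alpha> j} - m \<le> i \<and>
    \<not> exact_at TYPE('k) n (koszul G \<beta>) (i - (card {j. 0 < \<alpha> j} - m))"
proof -
  define U where "U = {j. e < \<beta> j}"
  define B where "B = {j. \<beta> j = e}"
  define B' where "B' = {j. \<alpha> j = e}"
  have U': "U = {j. e < \<alpha> j}" unfolding U_def
  proof (intro Collect_cong)
    fix j show "e < \<beta> j \<longleftrightarrow> e < \<alpha> j" using agree[of j] new[of j] by (cases "\<beta> j = 0") auto
  qed
  have BB': "B \<subseteq> B'" using agree e(1) by (force simp: B_def B'_def)
  have sa: "{j. 0 < \<alpha> j} = U \<union> B'"
  proof -
    have "0 < \<alpha> j \<longleftrightarrow> e < \<alpha> j \<or> \<alpha> j = e" for j using e(1) e(2)[of j] by linarith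
    then show ?thesis unfolding U' B'_def by blast
  qed
  have sb: "{j. 0 < \<beta> j} = U \<union> B"
  proof -
    have "0 < \<beta> j \<longleftrightarrow> e < \<beta> j \<or> \<beta> j = e" for j using e(1) e(3)[of j] by linarith
    then show ?thesis unfolding U_def B_def by blast
  qed
  have "U \<inter> B' = {}" by (auto simp: U' B'_def)
  moreover have "U \<inter> B = {}" by (auto simp: U_def B_def)
  ultimately have disj: "U \<inter> B' = {}" "U \<inter> B = {}" by simp_all
  have subn: "U \<union> B' \<subseteq> {..<n}" using supp_in_subset[OF \<alpha>] sa by simp
  then have fin: "finite U" "finite B'" by (auto intro: finite_subset)
  have finB: "finite B" using fin(2) BB' finite_subset by blast
  have cb: "m = card U + card B" using card sb card_Un_disjoint[OF fin(1) finB disj(2)] by simp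
  have ca: "card {j. 0 < \<alpha> j} = card U + card B'" using sa card_Un_disjoint[OF fin disj(1)] by simp
  have le: "card B \<le> card B'" using fin(2) BB' by (rule card_mono)
  have ka: "koszul G \<alpha> = stair (level \<alpha> e U) U B' 0"
    by (rule koszul_eq_stair[OF \<alpha> e(1,2) U' B'_def]) (use cb le in simp)
  have kb: "koszul G \<beta> = stair (level \<beta> e U) U B 0"
    by (rule koszul_eq_stair[OF \<beta> e(1,3) U_def B_def]) (use cb in simp)
  have "red \<alpha> F j = red \<beta> F j" if "j \<in> U" for j F
    using agree[of j] that by (auto simp: red_def U_def)
  then have lev: "level \<beta> e U = level \<alpha> e U"
    unfolding level_def by (intro ext bex_cong conj_cong all_cong1 imp_cong refl) (simp cong: conj_cong)
  have "B \<noteq> {}" using attained by (auto simp: B_def)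
  have "\<not> exact_at TYPE('k) n (stair (level \<alpha> e U) U B' 0) i \<longleftrightarrow>
    card B' - card B \<le> i \<and> \<not> exact_at TYPE('k) n (stair (level \<alpha> e U) U B 0) (i - (card B' - card B))"
    by (rule stair_shift[of "level \<alpha> e U" "m - card U", OF level_mono level_const fin disj(1) subn BB' \<open>B \<noteq> {}\<close>])
      (use cb in auto)
  moreover have "card {j. 0 < \<alpha> j} - m = card B' - card B" using ca cb by simp
  ultimately show ?thesis unfolding ka kb lev by simp
qed

text \<open>The increasing enumeration of the support squeezes \<alpha> onto an initial segment, so
  the class can be read off in as few variables as the support has elements.\<close>

lemma koszul_relabel:
  assumes a: "supp_in n \<alpha>" and ex: "\<not> exact_at TYPE('k::field) n (koszul G \<alpha>) i"
    and V: "V = {j. 0 < \<alpha> j}" and s: "card V \<le> s"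
  obtains \<beta> where "supp_in (card V) \<beta>" "\<beta> ` {..<card V} = \<alpha> ` V" "(\<Sum>l<card V. \<beta> l) = (\<Sum>l<n. \<alpha> l)"
    "\<not> exact_at TYPE('k) s (koszul G \<beta>) i"
proof -
  let ?c = "card V"
  have Vn: "V \<subseteq> {..<n}" using supp_in_subset[OF a] V by simp
  then have finV: "finite V" by (rule finite_subset) simp
  obtain f where f: "strict_mono_on {..<?c} f" "\<forall>l<?c. f l \<in> V"
    using finite_enumerate[OF finV] by blast
  have inj: "inj_on f {..<?c}" using f(1) by (rule strict_mono_on_imp_inj_on)
  have "f ` {..<?c} = V"
    by (rule card_subset_eq[OF finV]) (use f(2) card_image[OF inj] in auto)
  then have bij: "bij_betw f {..<?c} V" using inj by (simp add: bij_betw_def)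
  have im: "f ` {..<?c} = V" by fact
  define \<beta> where "\<beta> l = (if l < ?c then \<alpha> (f l) else 0)" for l
  have sb: "supp_in ?c \<beta>" by (simp add: supp_in_def \<beta>_def)
  have pos: "{l. 0 < \<beta> l} = {..<?c}" using f(2) V by (auto simp: \<beta>_def)
  have cn: "?c \<le> n" using card_mono[OF _ Vn] by simp
  have sum: "(\<Sum>l<?c. \<beta> l) = (\<Sum>l<n. \<alpha> l)"
  proof -
    have "(\<Sum>l<?c. \<beta> l) = (\<Sum>l\<in>{..<?c}. \<alpha> (f l))" by (simp add: \<beta>_def)
    also have "\<dots> = sum \<alpha> V" by (rule sum.reindex_bij_betw[OF bij])
    also have "\<dots> = (\<Sum>l<n. \<alpha> l)" using Vn V by (intro sum.mono_neutral_left) auto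
    finally show ?thesis .
  qed
  \<comment> \<open>Membership is decided by counting exponents alone, which the enumeration
    preserves.\<close>
  have "{F. F \<subseteq> {..<?c} \<and> f ` F \<in> koszul G \<alpha>} = koszul G \<beta>"
  proof (rule set_eqI)
    fix F
    show "F \<in> {F. F \<subseteq> {..<?c} \<and> f ` F \<in> koszul G \<alpha>} \<longleftrightarrow> F \<in> koszul G \<beta>"
    proof (cases "F \<subseteq> {..<?c}")
      case True
      have "card {j. t \<le> red \<alpha> (f ` F) j} = card {l. t \<le> red \<beta> F l}" if "0 < t" for t
      proof -
        have mem: "f l \<in> f ` F \<longleftrightarrow> l \<in> F" if "l < ?c" for l
          using inj True that by (auto simp: inj_on_def)
        have red: "red \<alpha> (f ` F) (f l) = red \<beta> F l" if "l < ?c" for l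
          using mem[OF that] that by (simp add: red_def \<beta>_def)
        have lt: "l < ?c" if "t \<le> red \<beta> F l" for l
          using that \<open>0 < t\<close> by (auto simp: red_def \<beta>_def split: if_splits)
        have "{j. t \<le> red \<alpha> (f ` F) j} = f ` {l. t \<le> red \<beta> F l}"
        proof (intro equalityI subsetI)
          fix j assume "j \<in> {j. t \<le> red \<alpha> (f ` F) j}"
          then have j: "t \<le> red \<alpha> (f ` F) j" by simp
          then have "j \<in> V" using \<open>0 < t\<close> V by (auto simp: red_def)
          then obtain l where "l < ?c" "j = f l" using im by auto
          then show "j \<in> f ` {l. t \<le> red \<beta> F l}" using j red by auto
        next
          fix j assume "j \<in> f ` {l. t \<le> red \<beta> F l}"
          then show "j \<in> {j. t \<le> red \<alpha> (f ` F) j}" using red lt by auto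
        qed
        moreover have "inj_on f {l. t \<le> red \<beta> F l}" by (rule inj_on_subset[OF inj]) (use lt in auto)
        ultimately show ?thesis by (simp add: card_image)
      qed
      moreover have "f ` F \<subseteq> V" using True im by blast
      ultimately show ?thesis using True unfolding mem_Collect_eq koszul_iff[OF a] koszul_iff[OF sb] pos V by auto
    next
      case False
      then show ?thesis unfolding koszul_iff[OF sb] pos by simp
    qed
  qed
  moreover have "koszul G \<alpha> \<subseteq> Pow V" by (auto simp: koszul_def V)
  ultimately have "\<not> exact_at TYPE('k) n (koszul G \<beta>) i"
    using exact_at_relabel[OF bij f(1) Vn, of "koszul G \<alpha>" i, where 'k='k] ex cn by auto
  \<comment> \<open>Both n and s are compared with \<open>card V\<close>, since either may be the
    larger.\<close>
  then have "\<not> exact_at TYPE('k) s (koszul G \<beta>) i"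
    using exact_at_dim_cong[OF cn koszul_Pow[OF sb], where 'k='k]
      exact_at_dim_cong[OF s koszul_Pow[OF sb], where 'k='k] by simp
  moreover have "\<beta> ` {..<?c} = \<alpha> ` V" using im by (force simp: \<beta>_def)
  ultimately show ?thesis using that sb sum by blast
qed

text \<open>No generator sees an exponent above all parts, so lowering it is free and gives a cone.
  This is what makes the set of segments finite. The inserted 0 keeps \<open>Max\<close> meaningful
  when there are no parts.\<close>

lemma koszul_exact_unbounded:
  assumes "supp_in n \<alpha>" "Max (insert 0 (\<Union>lam\<in>G. set lam)) < \<alpha> j"
  shows "exact_at TYPE('k::field) n (koszul G \<alpha>) i"
proof (rule koszul_cone[OF assms(1), of j])
  have fin: "finite (insert 0 (\<Union>lam\<in>G. set lam))" using finG by simp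
  have "npart lam (\<alpha> j) = 0" if "lam \<in> G" for lam
  proof -
    have "lam ! k < \<alpha> j" if "k < length lam" for k
    proof -
      have "lam ! k \<in> insert 0 (\<Union>lam\<in>G. set lam)" using that \<open>lam \<in> G\<close> nth_mem by blast
      then show ?thesis using Max_ge[OF fin] assms(2) by (metis le_less_trans)
    qed
    then have "{k. k < length lam \<and> \<alpha> j \<le> lam ! k} = {}" by (simp add: not_le)
    then show ?thesis unfolding npart_def by (simp only: card.empty)
  qed
  then show "m \<le> card {i. \<alpha> j < \<alpha> i} \<or> (\<forall>lam\<in>G. npart lam (\<alpha> j) = 0)" by blast
qed (use assms(2) in simp)

text \<open>Bounds the homological index by the support size. For \<alpha> = 0 this can fail in
  degree 0, namely when the ideal is the whole ring.\<close>

lemma koszul_exact_top: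
  assumes "supp_in n \<alpha>" "card {j. 0 < \<alpha> j} \<le> i" "0 < \<alpha> j"
  shows "exact_at TYPE('k::field) n (koszul G \<alpha>) i"
proof (rule exact_at_top[of "{j. 0 < \<alpha> j}" j])
  show "finite {j. 0 < \<alpha> j}" using supp_in_subset[OF assms(1)] by (rule finite_subset) simp
  show "j < n" using supp_in_subset[OF assms(1)] assms(3) by auto
  show "koszul G \<alpha> \<subseteq> Pow {j. 0 < \<alpha> j}" by (auto simp: koszul_def)
qed (use assms in auto)

text \<open>Locates a nonvanishing degree on a segment: \<beta> keeps all exponents above the
  minimum e and just enough copies of e to have m nonzero exponents; t counts the dropped
  copies.\<close>

lemma koszul_truncate:
  assumes a: "supp_in n \<alpha>" and ex: "\<not> exact_at TYPE('k::field) n (koszul G \<alpha>) i"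
    and big: "m \<le> card {j. 0 < \<alpha> j}"
  obtains e \<beta> t where "0 < e" "supp_in n \<beta>" "card {j. 0 < \<beta> j} = m" "\<And>j. \<beta> j = 0 \<or> e \<le> \<beta> j"
    "\<exists>j. \<beta> j = e" "card {j. 0 < \<alpha> j} = m + t" "(\<Sum>l<n. \<alpha> l) = (\<Sum>l<n. \<beta> l) + t * e"
    "t \<le> i" "\<not> exact_at TYPE('k) n (koszul G \<beta>) (i - t)"
proof -
  let ?V = "{j. 0 < \<alpha> j}"
  have Vn: "?V \<subseteq> {..<n}" by (rule supp_in_subset[OF a])
  then have finV: "finite ?V" by (rule finite_subset) simp
  have "?V \<noteq> {}" using big m by (metis card.empty not_one_le_zero order_trans)
  define e where "e = Min (\<alpha> ` ?V)"
  have "e \<in> \<alpha> ` ?V" unfolding e_def using finV \<open>?V \<noteq> {}\<close> by (intro Min_in) auto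
  then obtain j0 where j0: "0 < \<alpha> j0" "\<alpha> j0 = e" by auto
  have emin: "\<alpha> j = 0 \<or> e \<le> \<alpha> j" for j
    unfolding e_def using finV Min_le[of "\<alpha> ` ?V" "\<alpha> j"] by (cases "\<alpha> j = 0") auto
  define U where "U = {j. e < \<alpha> j}"
  define B' where "B' = {j. \<alpha> j = e}"
  have V: "?V = U \<union> B'"
  proof -
    have "0 < \<alpha> j \<longleftrightarrow> e < \<alpha> j \<or> \<alpha> j = e" for j using j0 emin[of j] by linarith
    then show ?thesis unfolding U_def B'_def by blast
  qed
  have fin: "finite U" "finite B'" using finV unfolding V by simp_all
  have disj: "U \<inter> B' = {}" by (auto simp: U_def B'_def)
  \<comment> \<open>With m exponents above e, the position j0 of exponent e would be an apex and the
    homology would vanish.\<close>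
  have "\<not> m \<le> card U"
  proof
    assume "m \<le> card U"
    then have "exact_at TYPE('k) n (koszul G \<alpha>) i"
      using j0 by (intro koszul_cone[OF a, of j0]) (auto simp: U_def)
    then show False using ex by simp
  qed
  then have cU: "card U < m" by simp
  have cV: "card ?V = card U + card B'" unfolding V by (rule card_Un_disjoint[OF fin disj])
  have "m - card U \<le> card B'" using cV big by simp
  then obtain B where B: "B \<subseteq> B'" "card B = m - card U" "finite B" by (rule obtain_subset_with_card_n)
  define \<beta> where "\<beta> j = (if j \<in> U \<union> B then \<alpha> j else 0)" for j
  define t where "t = card B' - card B"
  have pos: "{j. 0 < \<beta> j} = U \<union> B"
  proof -
    have "0 < \<alpha> j" if "j \<in> U \<union> B" for j using that B(1) V by blast
    then show ?thesis by (auto simp: \<beta>_def)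
  qed
  have sb: "supp_in n \<beta>" using a by (simp add: supp_in_def \<beta>_def)
  have cb: "card {j. 0 < \<beta> j} = m"
  proof -
    have "card (U \<union> B) = card U + card B" using disj B by (intro card_Un_disjoint fin) auto
    then show ?thesis using pos B(2) cU by simp
  qed
  have bmin: "\<beta> j = 0 \<or> e \<le> \<beta> j" for j using emin[of j] by (simp add: \<beta>_def)
  \<comment> \<open>As \<open>card U < m\<close>, part of the block survives, so \<beta> still
    attains e.\<close>
  have "B \<noteq> {}" using B(2) cU by auto
  then obtain b where "b \<in> B" by blast
  then have "\<beta> b = e" using B(1) by (auto simp: \<beta>_def B'_def)
  have new: "\<alpha> j \<le> e" if "\<beta> j = 0" for j
    using that by (cases "j \<in> U \<union> B") (auto simp: \<beta>_def U_def)
  have cVt: "card ?V = m + t" using cV B(2) cU big by (simp add: t_def)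
  have shift: "card ?V - m \<le> i \<and> \<not> exact_at TYPE('k) n (koszul G \<beta>) (i - (card ?V - m))"
    by (rule iffD1[OF koszul_shift[OF a sb _ emin bmin _ new cb] ex])
      (use j0 \<open>\<beta> b = e\<close> in \<open>auto simp: \<beta>_def split: if_splits\<close>)
  have sum: "(\<Sum>l<n. \<alpha> l) = (\<Sum>l<n. \<beta> l) + t * e"
  proof -
    have "(\<Sum>l<n. \<alpha> l) = sum \<alpha> ?V" using Vn by (intro sum.mono_neutral_right) auto
    also have "?V = (U \<union> B) \<union> (B' - B)" using V B(1) by blast
    also have "sum \<alpha> \<dots> = sum \<alpha> (U \<union> B) + sum \<alpha> (B' - B)"
      using fin B disj by (intro sum.union_disjoint) auto
    also have "sum \<alpha> (U \<union> B) = sum \<beta> (U \<union> B)" by (simp add: \<beta>_def)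
    also have "\<dots> = (\<Sum>l<n. \<beta> l)"
      using supp_in_subset[OF sb] unfolding pos by (intro sum.mono_neutral_left) (auto simp: \<beta>_def)
    also have "sum \<alpha> (B' - B) = (\<Sum>j\<in>B' - B. e)" by (rule sum.cong) (auto simp: B'_def)
    also have "\<dots> = t * e" using B(1,3) by (simp add: t_def card_Diff_subset)
    finally show ?thesis .
  qed
  show ?thesis
    by (rule that[OF _ sb cb bmin _ cVt sum]) (use j0 \<open>\<beta> b = e\<close> shift cVt in auto)
qed

text \<open>Converse of the truncation: k further variables with the minimal exponent e are
  appended, and \<open>koszul_shift\<close> moves the class by k.\<close>

lemma koszul_extend:
  assumes b: "supp_in m \<beta>" and ex: "\<not> exact_at TYPE('k::field) m (koszul G \<beta>) i"
    and e: "0 < e" "\<And>l. l < m \<Longrightarrow> e \<le> \<beta> l" "\<exists>l<m. \<beta> l = e" and k: "m + k \<le> n"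
  obtains \<alpha> where "supp_in n \<alpha>" "(\<Sum>l<n. \<alpha> l) = (\<Sum>l<m. \<beta> l) + k * e"
    "\<not> exact_at TYPE('k) n (koszul G \<alpha>) (i + k)"
proof -
  define \<alpha> where "\<alpha> l = (if l < m then \<beta> l else if l < m + k then e else 0)" for l
  have b0: "\<beta> l = 0 \<longleftrightarrow> m \<le> l" for l
    using b e(1) e(2)[of l] by (cases "l < m") (auto simp: supp_in_def)
  have sa: "supp_in n \<alpha>" using k by (simp add: supp_in_def \<alpha>_def)
  have sb: "supp_in n \<beta>" by (rule supp_in_mono[OF b]) (use k in simp)
  have "{l. 0 < \<beta> l} = {..<m}" using b0 by (auto simp: neq0_conv[symmetric] simp del: neq0_conv)
  then have cb: "card {l. 0 < \<beta> l} = m" by simp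
  have "{l. 0 < \<alpha> l} = {..<m + k}"
    using e(1) b0 by (auto simp: \<alpha>_def neq0_conv[symmetric] simp del: neq0_conv split: if_splits)
  then have ca: "card {l. 0 < \<alpha> l} - m = k" by simp
  have exb: "\<not> exact_at TYPE('k) n (koszul G \<beta>) i"
    using exact_at_dim_cong[OF _ koszul_Pow[OF b], of n, where 'k='k] k ex by simp
  have "\<not> exact_at TYPE('k) n (koszul G \<alpha>) (i + k)"
  proof (rule iffD2[OF koszul_shift[OF sa sb e(1) _ _ _ _ cb]])
    show "\<alpha> j = 0 \<or> e \<le> \<alpha> j" "\<beta> j = 0 \<or> e \<le> \<beta> j" for j
      using e(2)[of j] b0[of j] by (auto simp: \<alpha>_def)
    show "\<alpha> j = \<beta> j" if "0 < \<beta> j" for j using that b0[of j] by (auto simp: \<alpha>_def)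
    show "\<alpha> j \<le> e" if "\<beta> j = 0" for j using that b0[of j] by (auto simp: \<alpha>_def)
    show "\<exists>j. \<beta> j = e" using e(3) by blast
    show "card {j. 0 < \<alpha> j} - m \<le> i + k \<and>
      \<not> exact_at TYPE('k) n (koszul G \<beta>) (i + k - (card {j. 0 < \<alpha> j} - m))"
      unfolding ca using exb by simp
  qed
  moreover have "(\<Sum>l<n. \<alpha> l) = (\<Sum>l<m. \<beta> l) + k * e"
  proof -
    have "(\<Sum>l<n. \<alpha> l) = (\<Sum>l<m + k. \<alpha> l)"
      using k by (intro sum.mono_neutral_right) (auto simp: \<alpha>_def)
    also have "\<dots> = (\<Sum>l<m. \<alpha> l) + (\<Sum>l=m..<m + k. \<alpha> l)"
      using sum.atLeastLessThan_concat[of 0 m "m + k" \<alpha>] by (simp add: atLeast0LessThan)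
    also have "(\<Sum>l<m. \<alpha> l) = (\<Sum>l<m. \<beta> l)" by (simp add: \<alpha>_def)
    also have "(\<Sum>l=m..<m + k. \<alpha> l) = (\<Sum>l=m..<m + k. e)" by (intro sum.cong) (auto simp: \<alpha>_def)
    finally show ?thesis by simp
  qed
  ultimately show ?thesis using that sa by blast
qed

text \<open>The slope c is one less than the minimal exponent \<open>Suc c\<close> of \<beta>: a
  step adds \<open>Suc c\<close> to the total degree and 1 to the homological degree. The row j is
  total degree minus homological degree.\<close>

definition segments :: "'k::field itself \<Rightarrow> (nat \<times> nat \<times> nat) set" where
  "segments TYPE('k) = {(i, j, c). \<exists>\<beta>. supp_in m \<beta> \<and> (\<forall>l<m. c < \<beta> l) \<and> (\<exists>l<m. \<beta> l = Suc c) \<and>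
     (\<Sum>l<m. \<beta> l) = i + j \<and> \<not> exact_at TYPE('k) m (koszul G \<beta>) i}"

lemma segments_bounded:
  assumes "(i, j, c) \<in> segments TYPE('k::field)"
  shows "i < m" "j \<le> m * Max (insert 0 (\<Union>lam\<in>G. set lam))" "c \<le> Max (insert 0 (\<Union>lam\<in>G. set lam))"
proof -
  let ?M = "Max (insert 0 (\<Union>lam\<in>G. set lam))"
  obtain \<beta> where b: "supp_in m \<beta>" "\<forall>l<m. c < \<beta> l" "\<exists>l<m. \<beta> l = Suc c" "(\<Sum>l<m. \<beta> l) = i + j"
    "\<not> exact_at TYPE('k) m (koszul G \<beta>) i"
    using assms unfolding segments_def by blast
  have M: "\<beta> l \<le> ?M" for l
    using koszul_exact_unbounded[OF b(1), of l i, where 'k='k] b(5) by (meson not_le)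
  show "c \<le> ?M" using b(3) M by (metis Suc_leD)
  have "(\<Sum>l<m. \<beta> l) \<le> (\<Sum>l<m. ?M)" by (intro sum_mono M)
  then show "j \<le> m * ?M" using b(4) by simp
  have "card {l. 0 < \<beta> l} \<le> m" using card_mono[OF finite_lessThan supp_in_subset[OF b(1)]] by simp
  moreover obtain l where "0 < \<beta> l" using b(3) by (metis zero_less_Suc)
  ultimately show "i < m" using koszul_exact_top[OF b(1), of i l, where 'k='k] b(5) by (metis not_le order_trans)
qed

lemma finite_segments: "finite (segments TYPE('k::field))"
proof (rule finite_subset)
  let ?M = "Max (insert 0 (\<Union>lam\<in>G. set lam))"
  show "segments TYPE('k) \<subseteq> {..<m} \<times> {..m * ?M} \<times> {..?M}"
    using segments_bounded[where 'k='k] by auto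
qed simp

text \<open>A degree with fewer than m nonzero exponents is squeezed into m - 1 variables. Any other
  is truncated to m nonzero exponents, squeezed into m variables, and becomes the start of a
  segment.\<close>

lemma betti_nonzero_in_segments:
  assumes n: "m \<le> n" and nz: "betti TYPE('k::field) (restr_ideal G n) n i (i + j) \<noteq> 0"
  shows "(\<exists>(i', j', c) \<in> segments TYPE('k). (i, j) \<in> lseg (int i', int j') (int c) (n - m)) \<or>
    betti TYPE('k) (restr_ideal G (m - 1)) (m - 1) i (i + j) \<noteq> 0"
proof -
  obtain \<alpha> where ij: "0 \<le> i" "0 \<le> i + j" and a: "supp_in n \<alpha>" "(\<Sum>l<n. \<alpha> l) = nat (i + j)"
    and ex: "\<not> exact_at TYPE('k) n (koszul G \<alpha>) (nat i)"
    using nz unfolding betti_nonzero_iff by blast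
  show ?thesis
  proof (cases "m \<le> card {j. 0 < \<alpha> j}")
    case False
    let ?c = "card {j. 0 < \<alpha> j}"
    have c: "?c \<le> m - 1" using False by simp
    obtain \<beta> where b: "supp_in ?c \<beta>" "(\<Sum>l<?c. \<beta> l) = (\<Sum>l<n. \<alpha> l)"
      "\<not> exact_at TYPE('k) (m - 1) (koszul G \<beta>) (nat i)"
      by (rule koszul_relabel[OF a(1) ex refl c]) blast
    have "(\<Sum>l<m - 1. \<beta> l) = (\<Sum>l<?c. \<beta> l)"
      using b(1) c by (intro sum.mono_neutral_right) (auto simp: supp_in_def)
    then have "(\<Sum>l<m - 1. \<beta> l) = nat (i + j)" using b(2) a(2) by simp
    then show ?thesis unfolding betti_nonzero_iff using supp_in_mono[OF b(1) c] b(3) ij by blast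
  next
    case True
    obtain e \<gamma> t where e: "0 < e" and g: "supp_in n \<gamma>" "card {j. 0 < \<gamma> j} = m"
      "\<And>j. \<gamma> j = 0 \<or> e \<le> \<gamma> j" "\<exists>j. \<gamma> j = e" and t: "card {j. 0 < \<alpha> j} = m + t"
      "(\<Sum>l<n. \<alpha> l) = (\<Sum>l<n. \<gamma> l) + t * e" "t \<le> nat i"
      and exg: "\<not> exact_at TYPE('k) n (koszul G \<gamma>) (nat i - t)"
      by (rule koszul_truncate[OF a(1) ex True]) blast
    obtain \<beta> where b: "supp_in m \<beta>" "\<beta> ` {..<m} = \<gamma> ` {j. 0 < \<gamma> j}" "(\<Sum>l<m. \<beta> l) = (\<Sum>l<n. \<gamma> l)"
      "\<not> exact_at TYPE('k) m (koszul G \<beta>) (nat i - t)"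
      by (rule koszul_relabel[OF g(1) exg refl, of m]) (auto simp: g(2))
    have be: "e \<le> \<beta> l" if "l < m" for l
    proof -
      have "\<beta> l \<in> \<gamma> ` {j. 0 < \<gamma> j}" using that b(2) by blast
      then show ?thesis using g(3) by (metis (mono_tags, lifting) imageE mem_Collect_eq not_gr_zero)
    qed
    have "e \<in> \<gamma> ` {j. 0 < \<gamma> j}" using g(4) e by auto
    then have bex: "\<exists>l<m. \<beta> l = e" unfolding b(2)[symmetric] by auto
    have "0 < \<beta> 0" using be[of 0] e m by simp
    have i: "nat i - t < m"
    proof (rule ccontr)
      assume "\<not> nat i - t < m"
      moreover have "card {l. 0 < \<beta> l} \<le> m"
        using card_mono[OF finite_lessThan supp_in_subset[OF b(1)]] by simp
      ultimately show False using koszul_exact_top[OF b(1) _ \<open>0 < \<beta> 0\<close>, of "nat i - t", where 'k='k] b(4) by simp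
    qed
    \<comment> \<open>All m exponents are positive, so the total degree is at least m and exceeds
      \<open>nat i - t\<close>; the subtraction defining j' is therefore genuine.\<close>
    have "(\<Sum>l<m. 1) \<le> (\<Sum>l<m. \<beta> l)" using be e by (intro sum_mono) (simp add: Suc_le_eq less_le_trans)
    then have ms: "m \<le> (\<Sum>l<m. \<beta> l)" by simp
    define j' where "j' = (\<Sum>l<m. \<beta> l) - (nat i - t)"
    have j': "(\<Sum>l<m. \<beta> l) = (nat i - t) + j'" using ms i by (simp add: j'_def)
    have "(nat i - t, j', e - 1) \<in> segments TYPE('k)"
      unfolding segments_def mem_Collect_eq prod.case
      using b(1,4) be bex e j' by (intro exI[of _ \<beta>]) (fastforce simp: less_eq_Suc_le)
    moreover have "(i, j) \<in> lseg (int (nat i - t), int j') (int (e - 1)) (n - m)"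
    proof -
      have "card {j. 0 < \<alpha> j} \<le> n" using card_mono[OF finite_lessThan supp_in_subset[OF a(1)]] by simp
      then have "t \<le> n - m" using t(1) by simp
      moreover have "i = int (nat i - t) + int t" using t(3) ij(1) by simp
      \<comment> \<open>Each dropped variable accounts for e in the total degree and 1 in the
        homological degree, hence for \<open>e - 1\<close> in the row.\<close>
      moreover have "j = int j' + int (e - 1) * int t"
      proof -
        have "int (nat (i + j)) = int (nat i - t) + int j' + int t * int e"
          using a(2) t(2) b(3) j' by (metis of_nat_add of_nat_mult)
        then have "i + j = (i - int t) + int j' + int t * int e"
          using ij t(3) by simp
        moreover have "int (e - 1) = int e - 1" using e by simp
        ultimately show ?thesis by (simp add: algebra_simps)
      qed
      ultimately show ?thesis unfolding lseg_def by auto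
    qed
    ultimately show ?thesis by blast
  qed
qed

lemma segments_betti_nonzero:
  assumes s: "(i, j, c) \<in> segments TYPE('k::field)" and k: "m + k \<le> n"
  shows "betti TYPE('k) (restr_ideal G n) n (int i + int k) (int i + int k + (int j + int c * int k)) \<noteq> 0"
proof -
  obtain \<beta> where b: "supp_in m \<beta>" "\<forall>l<m. c < \<beta> l" "\<exists>l<m. \<beta> l = Suc c" "(\<Sum>l<m. \<beta> l) = i + j"
    "\<not> exact_at TYPE('k) m (koszul G \<beta>) i"
    using s unfolding segments_def by blast
  obtain \<alpha> where a: "supp_in n \<alpha>" "(\<Sum>l<n. \<alpha> l) = (\<Sum>l<m. \<beta> l) + k * Suc c"
    "\<not> exact_at TYPE('k) n (koszul G \<alpha>) (i + k)"
    by (rule koszul_extend[OF b(1,5) _ _ b(3) k]) (use b(2) in \<open>auto simp: Suc_le_eq\<close>)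
  have "nat (int i + int k) = i + k" by simp
  moreover have "nat (int i + int k + (int j + int c * int k)) = i + k + (j + c * k)"
    by (metis nat_int of_nat_add of_nat_mult)
  moreover have "(\<Sum>l<n. \<alpha> l) = i + k + (j + c * k)" using a(2) b(4) by (simp add: algebra_simps)
  ultimately show ?thesis unfolding betti_nonzero_iff using a(1,3) by auto
qed

text \<open>The same \<alpha> serves in more variables. This places the Betti numbers for m - 1
  variables inside those for n.\<close>

lemma betti_nonzero_mono:
  assumes "n' \<le> n" and nz: "betti TYPE('k::field) (restr_ideal G n') n' i j \<noteq> 0"
  shows "betti TYPE('k) (restr_ideal G n) n i j \<noteq> 0"
proof -
  obtain \<alpha> where ij: "0 \<le> i" "0 \<le> j" and a: "supp_in n' \<alpha>" "(\<Sum>l<n'. \<alpha> l) = nat j"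
    "\<not> exact_at TYPE('k) n' (koszul G \<alpha>) (nat i)"
    using nz unfolding betti_nonzero_iff by blast
  have "(\<Sum>l<n. \<alpha> l) = (\<Sum>l<n'. \<alpha> l)"
    using a(1) assms(1) by (intro sum.mono_neutral_right) (auto simp: supp_in_def)
  moreover have "\<not> exact_at TYPE('k) n (koszul G \<alpha>) (nat i)"
    using exact_at_dim_cong[OF assms(1) koszul_Pow[OF a(1)], where 'k='k] a(3) by simp
  ultimately show ?thesis unfolding betti_nonzero_iff using ij a(2) supp_in_mono[OF a(1) assms(1)] by auto
qed

lemma betti_segments_eq:
  assumes n: "m \<le> n"
  shows "{(i :: int, j :: int). betti TYPE('k::field) (restr_ideal G n) n i (i + j) \<noteq> 0} =
      (\<Union>(i, j, c)\<in>segments TYPE('k). lseg (int i, int j) (int c) (n - m)) \<union>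
      {(i :: int, j :: int). betti TYPE('k) (restr_ideal G (m - 1)) (m - 1) i (i + j) \<noteq> 0}"
    (is "?L = ?S \<union> ?R")
proof (intro equalityI subsetI)
  fix p assume "p \<in> ?L"
  then obtain i j where p: "p = (i, j)" "betti TYPE('k) (restr_ideal G n) n i (i + j) \<noteq> 0" by auto
  show "p \<in> ?S \<union> ?R" using betti_nonzero_in_segments[OF n p(2)] p(1) by auto
next
  fix p assume "p \<in> ?S \<union> ?R"
  then show "p \<in> ?L"
  proof
    assume "p \<in> ?R"
    then show "p \<in> ?L" using betti_nonzero_mono[of "m - 1" n, where 'k='k] n by auto
  next
    assume "p \<in> ?S"
    then obtain i j c k where s: "(i, j, c) \<in> segments TYPE('k)" and "k \<le> n - m"
      and p: "p = (int i + int k, int j + int c * int k)"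
      unfolding lseg_def by auto
    then have "m + k \<le> n" using n by simp
    from segments_betti_nonzero[OF s this] show "p \<in> ?L" unfolding p by simp
  qed
qed

end

theorem theorem1p2:
  fixes G :: "nat list set" and m :: nat
  assumes "finite G"
    and "\<forall>lam\<in>G. is_partition lam \<and> length lam \<le> m"
    and "1 \<le> m"
  shows "\<exists>D :: (nat \<times> nat \<times> nat) set. finite D \<and> (\<forall>(i, j, c)\<in>D. i < m) \<and>
    (\<forall>n\<ge>m.
      {(i :: int, j :: int). betti TYPE('k::field) (restr_ideal G n) n i (i + j) \<noteq> 0} =
      (\<Union>(i, j, c)\<in>D. lseg (int i, int j) (int c) (n - m)) \<union>
      {(i :: int, j :: int). betti TYPE('k) (restr_ideal G (m - 1)) (m - 1) i (i + j) \<noteq> 0})"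
proof (intro exI conjI allI impI)
  \<comment> \<open>\<open>segments\<close> refers to m variables only, so one set serves every
    n.\<close>
  let ?D = "segments G m TYPE('k)"
  show "finite ?D" by (rule finite_segments[OF assms])
  show "\<forall>(i, j, c)\<in>?D. i < m" using segments_bounded(1)[OF assms, where 'k='k] by blast
  fix n assume "m \<le> n"
  then show "{(i :: int, j :: int). betti TYPE('k) (restr_ideal G n) n i (i + j) \<noteq> 0} =
      (\<Union>(i, j, c)\<in>?D. lseg (int i, int j) (int c) (n - m)) \<union>
      {(i :: int, j :: int). betti TYPE('k) (restr_ideal G (m - 1)) (m - 1) i (i + j) \<noteq> 0}"
    by (rule betti_segments_eq[OF assms])
qed

end
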